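(* Let $n\ge 6$ be even and let $\pi$ be a permutation of $[n]=\{1,\dots,n\}$. If $rt(C_n,\pi)=n-1$, then $\pi$ is the rotation $23\cdots n1$ or its inverse; that is, either $\pi(i)\equiv i+1 \pmod n$ for all $i\in[n]$, or $\pi(i)\equiv i-1\pmod n$ for all $i\in[n]$.
   Context: $C_n$ is the cycle with vertices $1,2,\dots,n$ labeled in cyclic order (edges $\{i,i+1\}$, indices mod $n$). For a permutation $\pi$ of $[n]$, a pebble $p_i$ with destination $\pi(i)$ is initially placed at vertex $i$, for each $i\in[n]$. At each step one chooses a matching of $C_n$ and, for every edge of the matching, swaps the two pebbles at its endpoints. $rt(C_n,\pi)$ is the minimum number of steps after which every pebble can be at its destination. Permutations are written in one-line notation $\pi(1)\pi(2)\cdots\pi(n)$. *)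

theory Defs
  imports "HOL-Number_Theory.Cong" "HOL-Combinatorics.Permutations"
begin

text \<open>Undirected graphs are given by a vertex set and a set of edges, each edge being the set of
  its endpoints.\<close>

definition cycle_vertices :: "nat \<Rightarrow> nat set" where
  "cycle_vertices n = {1..n}"

text \<open>\<^term>\<open>i mod n + 1\<close> is the cyclic successor of \<^term>\<open>i\<close> in \<^term>\<open>{1..n::nat}\<close>; this is
  the cycle for \<^prop>\<open>n \<ge> (3::nat)\<close>.\<close>

definition cycle_edges :: "nat \<Rightarrow> nat set set" where
  "cycle_edges n = {{i, i mod n + 1} | i. i \<in> {1..n}}"

definition matching :: "'a set set \<Rightarrow> 'a set set \<Rightarrow> bool" where
  "matching E M \<longleftrightarrow> M \<subseteq> E \<and> (\<forall>e\<in>M. \<forall>f\<in>M. e \<noteq> f \<longrightarrow> e \<inter> f = {})"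

text \<open>The new vertex of the pebble located at \<^term>\<open>v\<close> once the pebbles at the two endpoints of
  every edge of \<^term>\<open>M\<close> have been exchanged. The definite description is meaningful when
  \<^term>\<open>M\<close> is a matching.\<close>

definition swap_along :: "'a set set \<Rightarrow> 'a \<Rightarrow> 'a" where
  "swap_along M v = (if \<exists>w. {v, w} \<in> M then (THE w. {v, w} \<in> M) else v)"

text \<open>A configuration \<^term>\<open>p\<close> sends \<^term>\<open>i\<close> to the current vertex of the pebble that started at
  \<^term>\<open>i\<close>. The empty matching is allowed, which does not affect the minimum below.\<close>

definition pebble_step :: "'a set set \<Rightarrow> ('a \<Rightarrow> 'a) \<Rightarrow> ('a \<Rightarrow> 'a) \<Rightarrow> bool" where
  "pebble_step E p q \<longleftrightarrow> (\<exists>M. matching E M \<and> q = swap_along M \<circ> p)"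

definition routable_in :: "'a set \<Rightarrow> 'a set set \<Rightarrow> ('a \<Rightarrow> 'a) \<Rightarrow> nat \<Rightarrow> bool" where
  "routable_in V E \<pi> t \<longleftrightarrow> (\<exists>q. (pebble_step E ^^ t) id q \<and> (\<forall>v\<in>V. q v = \<pi> v))"

text \<open>On a finite connected graph every permutation of the vertices is routable, so that this
  minimum is attained.\<close>

definition rt :: "'a set \<Rightarrow> 'a set set \<Rightarrow> ('a \<Rightarrow> 'a) \<Rightarrow> nat" where
  "rt V E \<pi> = (LEAST t. routable_in V E \<pi> t)"

end

theory Submission
  imports Defs
begin

text \<open>Lift \<^term>\<open>\<pi>\<close> to a map \<open>f\<close> on the integers with \<open>f (i + n) = f i + n\<close>, where \<open>f i - i\<close> is the signed
  distance that the pebble at \<open>i\<close> has to travel; the choice of directions is free as long as the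
  distances add up to zero over a period. Routing on an even cycle becomes odd-even transposition
  sort of \<open>f\<close>. Choosing \<open>f\<close> with minimal sum of squares confines the distances to an interval
  \<open>[-p, q]\<close> with \<open>p + q = n\<close>, and \<open>p, q \<ge> 2\<close> unless \<open>\<pi>\<close> is one of the two rotations. By the 0-1
  principle, the sort needs more than \<open>n - 2\<close> steps only if some threshold turns a window of length
  \<open>n\<close> into the word \<open>1\<^sup>p 0\<^sup>q\<close> or, for one of the two parities of the first step, into a word that is
  one transposition away from it. If both parities fail, then a few thresholds determine the words
  almost completely, and exchanging the directions of one pebble with distance \<open>q\<close> and one with
  distance \<open>-p\<close> removes the obstruction.\<close>

subsection \<open>Periodic maps on the integers\<close>

text \<open>These are the elements of the affine symmetric group. Injectivity on residues stands in
  for bijectivity, and the vanishing sum says that clockwise and anticlockwise distances balance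
  over one period.\<close>

definition affine_perm :: "int \<Rightarrow> (int \<Rightarrow> int) \<Rightarrow> bool" where
  "affine_perm n f \<longleftrightarrow> (\<forall>i. f (i + n) = f i + n) \<and>
    (\<forall>i j. [f i = f j] (mod n) \<longrightarrow> [i = j] (mod n)) \<and> (\<Sum>i\<in>{0..<n}. f i - i) = 0"

lemma periodic_mult:
  fixes f :: "int \<Rightarrow> int"
  assumes "\<And>i. f (i + n) = f i + n"
  shows "f (i + k * n) = f i + k * n"
proof (induction k rule: int_induct[where k = 0])
  case base
  show ?case by simp
next
  case (step1 k)
  then show ?case using assms[of "i + k * n"] by (simp add: algebra_simps)
next
  case (step2 k)
  then show ?case using assms[of "i + (k - 1) * n"] by (simp add: algebra_simps)
qed

lemma periodic_cong:
  fixes f :: "int \<Rightarrow> int"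
  assumes "\<And>i. f (i + n) = f i + n" "[i = j] (mod n)"
  shows "f i - i = f j - j"
proof -
  from assms(2) obtain k where "j = i + k * n"
    by (metis cong_iff_lin mult.commute)
  then show ?thesis using periodic_mult[of f n i k] assms(1) by simp
qed

lemma sum_period_shift:
  fixes g :: "int \<Rightarrow> int"
  assumes "0 < n" and per: "\<And>i. g (i + n) = g i"
  shows "sum g {a..<a + n} = sum g {0..<n}"
proof -
  have step: "sum g {a + 1..<a + 1 + n} = sum g {a..<a + n}" for a
  proof -
    have "{a..<a + n} = insert a {a + 1..<a + n}" "{a + 1..<a + 1 + n} = insert (a + n) {a + 1..<a + n}"
      using \<open>0 < n\<close> by auto
    then show ?thesis using per[of a] by simp
  qed
  show ?thesis
  proof (induction a rule: int_induct[where k = 0])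
    case base
    show ?case by simp
  next
    case (step1 i)
    then show ?case using step[of i] by simp
  next
    case (step2 i)
    then show ?case using step[of "i - 1"] by simp
  qed
qed

lemma affine_perm_sum:
  assumes "affine_perm n f" "0 < n"
  shows "(\<Sum>i\<in>{a..<a + n}. f i - i) = 0"
  using sum_period_shift[of n "\<lambda>i. f i - i" a] assms by (auto simp: affine_perm_def)

subsection \<open>Odd-even transposition sort\<close>

text \<open>The active edges join \<open>i\<close> and \<open>i + 1\<close> with
  \<open>i - c\<close> even, and an out-of-order pair on an active edge is exchanged. Since this is
  an involution, composing \<open>f\<close> with it yields the rearranged sequence.\<close>

definition oe_move :: "int \<Rightarrow> (int \<Rightarrow> int) \<Rightarrow> int \<Rightarrow> int" where
  "oe_move c f i =
    (if even (i - c) then (if f (i + 1) < f i then i + 1 else i)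
     else (if f i < f (i - 1) then i - 1 else i))"

definition oe_step :: "int \<Rightarrow> (int \<Rightarrow> int) \<Rightarrow> int \<Rightarrow> int" where
  "oe_step c f = f \<circ> oe_move c f"

lemma oe_move_invol: "oe_move c f (oe_move c f i) = i"
  unfolding oe_move_def by auto

lemma oe_step_left: "even (i - c) \<Longrightarrow> oe_step c f i = min (f i) (f (i + 1))"
  by (auto simp: oe_step_def oe_move_def)

lemma oe_step_right: "odd (i - c) \<Longrightarrow> oe_step c f i = max (f (i - 1)) (f i)"
  by (auto simp: oe_step_def oe_move_def)

lemma oe_step_move: "oe_step c f (oe_move c f i) = f i"
  by (simp add: oe_step_def oe_move_invol)

lemma oe_move_periodic:
  assumes "even n" "\<And>i. f (i + n) = f i + n"
  shows "oe_move c f (i + n) = oe_move c f i + n"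
proof -
  have "f (i + n + 1) = f (i + 1) + n" "f (i + n - 1) = f (i - 1) + n"
    using assms(2)[of "i + 1"] assms(2)[of "i - 1"] by (simp_all add: algebra_simps)
  moreover have "even (i + n - c) = even (i - c)" using assms(1) by simp
  ultimately show ?thesis using assms(2)[of i] by (simp add: oe_move_def)
qed

lemma affine_perm_oe_step:
  assumes "affine_perm n f" "0 < n" "even n"
  shows "affine_perm n (oe_step c f)"
proof -
  have per: "f (i + n) = f i + n" for i using assms(1) by (simp add: affine_perm_def)
  have mper: "oe_move c f (i + n) = oe_move c f i + n" for i
    using oe_move_periodic[of n f, OF assms(3) per] .
  have "[i = j] (mod n)" if "[oe_step c f i = oe_step c f j] (mod n)" for i j
  proof -
    have "[oe_move c f i = oe_move c f j] (mod n)"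
      using that assms(1) by (auto simp: affine_perm_def oe_step_def)
    \<comment> \<open>Periodicity of \<open>oe_move\<close> is applied at the moved points, which
      the involution sends back to \<open>i\<close> and \<open>j\<close>.\<close>
    have "i - oe_move c f i = j - oe_move c f j"
      using periodic_cong[of "oe_move c f", OF mper \<open>[oe_move c f i = oe_move c f j] (mod n)\<close>] by (simp add: oe_move_invol)
    then have "oe_move c f i - oe_move c f j = i - j" by simp
    with \<open>[oe_move c f i = oe_move c f j] (mod n)\<close> show ?thesis by (metis cong_iff_dvd_diff)
  qed
  moreover have "(\<Sum>i\<in>{0..<n}. oe_step c f i - i) = 0"
  proof -
    \<comment> \<open>The window starts at the left end of an active edge and has even length, so no
      active edge crosses its boundary.\<close>
    have "(\<Sum>i\<in>{c..<c + n}. f (oe_move c f i)) = (\<Sum>i\<in>{c..<c + n}. f i)"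
    proof (rule sum.reindex_bij_witness[where i = "oe_move c f" and j = "oe_move c f"])
      fix i assume i: "i \<in> {c..<c + n}"
      have "i + 1 < c + n" if "even (i - c)"
      proof -
        have "i + 1 \<noteq> c + n" using that assms(3) by presburger
        then show ?thesis using i by auto
      qed
      moreover have "c \<le> i - 1" if "odd (i - c)"
      proof -
        have "i \<noteq> c" using that by auto
        then show ?thesis using i by auto
      qed
      ultimately show "oe_move c f i \<in> {c..<c + n}" using i by (auto simp: oe_move_def)
      then show "oe_move c f i \<in> {c..<c + n}" .
    qed (auto simp: oe_move_invol)
    then have "(\<Sum>i\<in>{c..<c + n}. oe_step c f i - i) = 0"
      using affine_perm_sum[OF assms(1,2), of c] by (simp add: oe_step_def sum_subtractf)
    then show ?thesis
      using sum_period_shift[of n "\<lambda>i. oe_step c f i - i" c] assms(2) per mper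
      by (simp add: oe_step_def)
  qed
  ultimately show ?thesis
    using per mper by (auto simp: affine_perm_def oe_step_def)
qed

text \<open>The number of steps that an entry at position \<^term>\<open>z\<close> loses at the start, as the edge on its
  left is not active in the first step.\<close>

definition idle :: "int \<Rightarrow> int \<Rightarrow> nat" where
  "idle c z = (if even (z - c) then 1 else 0)"

text \<open>The entry at position \<^term>\<open>z\<close> that counts as low for the threshold \<^term>\<open>k\<close> must pass the
  high entries on its left, and it may wait for the low entries on its right.\<close>

definition sort_bound :: "nat \<Rightarrow> int \<Rightarrow> (int \<Rightarrow> int) \<Rightarrow> bool" where
  "sort_bound T c f \<longleftrightarrow> (\<forall>k z. f z \<le> k \<longrightarrow> (\<exists>i<z. k < f i) \<longrightarrow>
     card {i. i < z \<and> k < f i} + card {i. z < i \<and> f i \<le> k} + idle c z \<le> T)"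

lemma finite_low_high:
  assumes "\<And>i. \<bar>f i - i\<bar> \<le> (B::int)"
  shows "finite {i. i < z \<and> k < f i}" "finite {i. z < i \<and> f i \<le> k}"
proof -
  have "{i. i < z \<and> k < f i} \<subseteq> {k - B..z}"
  proof
    fix i assume "i \<in> {i. i < z \<and> k < f i}"
    then show "i \<in> {k - B..z}" using assms[of i] by auto
  qed
  then show "finite {i. i < z \<and> k < f i}" by (rule finite_subset) simp
  have "{i. z < i \<and> f i \<le> k} \<subseteq> {z..k + B}"
  proof
    fix i assume "i \<in> {i. z < i \<and> f i \<le> k}"
    then show "i \<in> {z..k + B}" using assms[of i] by auto
  qed
  then show "finite {i. z < i \<and> f i \<le> k}" by (rule finite_subset) simp
qed

text \<open>Minima and maxima of neighbouring values inherit the bound. This keeps all the counted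
  sets finite throughout the sort.\<close>

lemma near_oe_step:
  assumes "\<And>i. \<bar>f i - i\<bar> \<le> (B::int)"
  shows "\<bar>oe_step c f i - i\<bar> \<le> B"
  using assms[of i] assms[of "i + 1"] assms[of "i - 1"]
  by (cases "even (i - c)") (auto simp: oe_step_left oe_step_right min_def max_def)

text \<open>The edge between \<open>a - 1\<close> and \<open>a\<close> is not active, so the step
  only permutes the positions left of \<open>a\<close>.\<close>

lemma card_high_oe_step:
  assumes "even (a - c)"
  shows "card {i. i < a \<and> k < oe_step c f i} = card {i. i < a \<and> k < f i}"
proof (rule bij_betw_same_card[of "oe_move c f"], rule bij_betw_byWitness[where f' = "oe_move c f"])
  have *: "oe_move c f i < a" if "i < a" for i
  proof (cases "even (i - c)")
    case True
    then have "i + 1 \<noteq> a" using assms by presburger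
    then show ?thesis using that by (auto simp: oe_move_def)
  qed (use that in \<open>auto simp: oe_move_def\<close>)
  show "oe_move c f ` {i. i < a \<and> k < oe_step c f i} \<subseteq> {i. i < a \<and> k < f i}"
    using * by (auto simp: oe_step_def)
  show "oe_move c f ` {i. i < a \<and> k < f i} \<subseteq> {i. i < a \<and> k < oe_step c f i}"
    using * by (auto simp: oe_step_move)
qed (auto simp: oe_move_invol)

lemma card_low_oe_step:
  assumes "even (a - c)"
  shows "card {i. a + 1 < i \<and> oe_step c f i \<le> k} = card {i. a + 1 < i \<and> f i \<le> k}"
proof (rule bij_betw_same_card[of "oe_move c f"], rule bij_betw_byWitness[where f' = "oe_move c f"])
  have *: "a + 1 < oe_move c f i" if "a + 1 < i" for i
  proof (cases "even (i - c)")
    case False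
    then have "i - 1 \<noteq> a + 1" using assms by presburger
    then show ?thesis using that by (auto simp: oe_move_def)
  qed (use that in \<open>auto simp: oe_move_def\<close>)
  show "oe_move c f ` {i. a + 1 < i \<and> oe_step c f i \<le> k} \<subseteq> {i. a + 1 < i \<and> f i \<le> k}"
    using * by (auto simp: oe_step_def)
  show "oe_move c f ` {i. a + 1 < i \<and> f i \<le> k} \<subseteq> {i. a + 1 < i \<and> oe_step c f i \<le> k}"
    using * by (auto simp: oe_step_move)
qed (auto simp: oe_move_invol)

text \<open>Only the active pair containing \<open>z\<close> matters, as the counts on both sides of
  it are unchanged. In that pair a lone low entry either passes a high one or stops idling, and of
  two low entries the right one takes over the idling from the left one. In each case the bound
  drops by one.\<close>

lemma sort_bound_oe_step:
  assumes near: "\<And>i. \<bar>f i - i\<bar> \<le> (B::int)" and sb: "sort_bound (Suc T) c f"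
  shows "sort_bound T (c + 1) (oe_step c f)"
  unfolding sort_bound_def
proof (intro allI impI)
  fix k z
  let ?g = "oe_step c f"
  assume z: "?g z \<le> k" and ex: "\<exists>i<z. k < ?g i"
  \<comment> \<open>The active pair containing \<open>z\<close> is \<open>a\<close>,
    \<open>a + 1\<close>.\<close>
  define a where "a = (if even (z - c) then z else z - 1)"
  have ea: "even (a - c)" unfolding a_def by auto
  let ?L = "card {i. i < a \<and> k < f i}" and ?R = "card {i. a + 1 < i \<and> f i \<le> k}"
  note fin = finite_low_high[of f, OF near]
  note fing = finite_low_high[of ?g, OF near_oe_step[OF near]]
  have L1: "{i. i < a + 1 \<and> k < h i} = (if k < h a then insert a {i. i < a \<and> k < h i} else {i. i < a \<and> k < h i})"
    for h :: "int \<Rightarrow> int"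
  proof -
    have "i < a + 1 \<longleftrightarrow> i = a \<or> i < a" for i by auto
    then show ?thesis by auto
  qed
  have R1: "{i. a < i \<and> h i \<le> k} = (if h (a + 1) \<le> k then insert (a + 1) {i. a + 1 < i \<and> h i \<le> k} else {i. a + 1 < i \<and> h i \<le> k})"
    for h :: "int \<Rightarrow> int"
  proof -
    have "a < i \<longleftrightarrow> i = a + 1 \<or> a + 1 < i" for i by auto
    then show ?thesis by auto
  qed
  have Lf: "card {i. i < a + 1 \<and> k < f i} = ?L + (if k < f a then 1 else 0)"
    unfolding L1[of f] using fin(1)[of a k] by simp
  have Lg: "card {i. i < a + 1 \<and> k < ?g i} = ?L + (if k < ?g a then 1 else 0)"
    unfolding L1[of ?g] using fing(1)[of a k] by (simp add: card_high_oe_step[OF ea])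
  have Rf: "card {i. a < i \<and> f i \<le> k} = ?R + (if f (a + 1) \<le> k then 1 else 0)"
    unfolding R1[of f] using fin(2)[of "a + 1" k] by simp
  have Rg: "card {i. a < i \<and> ?g i \<le> k} = ?R + (if ?g (a + 1) \<le> k then 1 else 0)"
    unfolding R1[of ?g] using fing(2)[of "a + 1" k] by (simp add: card_low_oe_step[OF ea])
  have ga: "?g a = min (f a) (f (a + 1))" "?g (a + 1) = max (f a) (f (a + 1))"
    using ea oe_step_left[of a c f] oe_step_right[of "a + 1" c f] by auto
  \<comment> \<open>The bound speaks only of low entries with a high entry to their left, so such an
    entry must already exist before the step.\<close>
  have ex': "k < f a \<or> (\<exists>i<a. k < f i)"
  proof (rule ccontr)
    assume n: "\<not> ?thesis"
    then have "{i. i < a \<and> k < f i} = {}" by auto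
    then have "card {i. i < a \<and> k < ?g i} = 0" using card_high_oe_step[OF ea, of k f] by (metis card.empty)
    then have "{i. i < a \<and> k < ?g i} = {}" using fing(1)[of a k] by simp
    then have "\<forall>i<a. ?g i \<le> k" by (auto simp: not_less[symmetric])
    moreover have "?g a \<le> k" using n ga by auto
    ultimately have "\<forall>i<a+1. ?g i \<le> k" by (auto simp only: zless_add1_eq)
    moreover have "z \<le> a + 1" by (simp add: a_def)
    moreover obtain i where "i < z" "k < ?g i" using ex by blast
    ultimately have "?g i \<le> k" by simp
    then show False using \<open>k < ?g i\<close> by simp
  qed
  have ida: "idle c a = 1" "idle c (a + 1) = 0" "idle (c + 1) a = 0" "idle (c + 1) (a + 1) = 1"
    using ea by (auto simp: idle_def)
  have bnda: "?L + card {i. a < i \<and> f i \<le> k} + 1 \<le> Suc T" if "f a \<le> k"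
  proof -
    have "\<exists>i<a. k < f i" using ex' that by auto
    then show ?thesis using sb[unfolded sort_bound_def, rule_format, of a k] that ida by simp
  qed
  have bndb: "card {i. i < a + 1 \<and> k < f i} + ?R + 0 \<le> Suc T" if "f (a + 1) \<le> k"
  proof -
    have "\<exists>i<a+1. k < f i" using ex' by (metis zless_add1_eq)
    then show ?thesis using sb[unfolded sort_bound_def, rule_format, of "a + 1" k] that ida by simp
  qed
  show "card {i. i < z \<and> k < ?g i} + card {i. z < i \<and> ?g i \<le> k} + idle (c + 1) z \<le> T"
  proof (cases "even (z - c)")
    case True
    then have za: "z = a" by (simp add: a_def)
    show ?thesis using bnda bndb z unfolding za ida card_high_oe_step[OF ea] Rg Rf Lf ga
      by (auto split: if_splits simp: min_def max_def)
  next
    case False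
    then have za: "z = a + 1" by (simp add: a_def)
    show ?thesis using bnda bndb z unfolding za ida Lg card_low_oe_step[OF ea] Rf Lf ga
      by (auto split: if_splits simp: min_def max_def)
  qed
qed

text \<open>Without inversions \<open>f\<close> is increasing, so \<open>f i - i\<close> never
  decreases. Being periodic it is constant, and the zero sum makes the constant 0.\<close>

lemma sort_bound_0:
  assumes "affine_perm n f" "0 < n" and near: "\<And>i. \<bar>f i - i\<bar> \<le> (B::int)" and sb: "sort_bound 0 c f"
  shows "f i = i"
proof -
  have per: "f (i + n) = f i + n" for i using assms(1) by (simp add: affine_perm_def)
  have mono: "f i \<le> f j" if "i < j" for i j
  proof (rule ccontr)
    assume "\<not> ?thesis"
    then have "i \<in> {i. i < j \<and> f j < f i}" using that by auto
    moreover from this have "card {i. i < j \<and> f j < f i} = 0"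
      using sb[unfolded sort_bound_def, rule_format, of j "f j"] that by auto
    ultimately show False using finite_low_high(1)[of f, OF near, of j "f j"] by auto
  qed
  \<comment> \<open>Modulo 1 neighbours are congruent, so this argument leaves out
    \<open>n = 1\<close>, where periodicity alone gives the conclusion below.\<close>
  have inc: "f j + 1 \<le> f (j + 1)" if "n \<noteq> 1" for j
  proof -
    have "f j \<noteq> f (j + 1)"
    proof
      assume "f j = f (j + 1)"
      then have "[j = j + 1] (mod n)" using assms(1) by (simp add: affine_perm_def)
      then have "n dvd 1" by (simp add: cong_iff_dvd_diff)
      then show False using that assms(2) by simp
    qed
    then show ?thesis using mono[of j "j + 1"] by simp
  qed
  have inc': "f j - j \<le> f (j + 1) - (j + 1)" for j
    using inc[of j] per[of j] by (cases "n = 1") auto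
  have up: "f j - j \<le> f (j + int m) - (j + int m)" for j m
  proof (induction m)
    case (Suc m)
    then show ?case using inc'[of "j + int m"] by (simp add: algebra_simps)
  qed simp
  have const: "f j - j = f i - i" if "j \<in> {i..<i + n}" for j
  proof -
    have "f i - i \<le> f j - j" using up[of i "nat (j - i)"] that by simp
    moreover have "f j - j \<le> f (i + n) - (i + n)" using up[of j "nat (i + n - j)"] that by simp
    ultimately show ?thesis using per[of i] by simp
  qed
  have "0 = (\<Sum>j\<in>{i..<i + n}. f j - j)" using affine_perm_sum[OF assms(1,2)] by simp
  also have "\<dots> = (\<Sum>j\<in>{i..<i + n}. f i - i)" by (intro sum.cong refl const)
  also have "\<dots> = n * (f i - i)" using assms(2) by simp
  finally show ?thesis using assms(2) by simp
qed

subsection \<open>Routing by odd-even transpositions\<close>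

definition oe_matching :: "nat \<Rightarrow> int \<Rightarrow> (int \<Rightarrow> int) \<Rightarrow> nat set set" where
  "oe_matching n c f =
    {{v, v mod n + 1} | v. v \<in> {1..n} \<and> even (int v - c) \<and> f (int v + 1) < f (int v)}"

lemma cycle_succ: "(v::nat) \<in> {1..n} \<Longrightarrow> v mod n + 1 = (if v = n then 1 else v + 1)"
  by auto

lemma cycle_succ_cong: "[int (v mod n + 1) = int v + 1] (mod int n)"
  unfolding cong_def of_nat_add zmod_int of_nat_1 by (rule mod_add_left_eq)

lemma odd_cycle_succ:
  assumes "(v::nat) \<in> {1..n}" "even n"
  shows "even (int (v mod n + 1) - c) \<longleftrightarrow> odd (int v - c)"
  unfolding cycle_succ[OF assms(1)] using assms(2) by auto

lemma cycle_succ_inj: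
  fixes v w :: nat
  assumes "v \<in> {1..n}" "w \<in> {1..n}" "v mod n + 1 = w mod n + 1"
  shows "v = w"
  using assms cycle_succ[OF assms(1)] cycle_succ[OF assms(2)]
  by (cases "v = n"; cases "w = n") simp_all

text \<open>For even \<open>n\<close> parity is well defined around the cycle: every edge starts at
  a vertex of the parity of \<open>c\<close> and ends at one of the other parity.\<close>

lemma matching_oe:
  assumes "even n"
  shows "matching (cycle_edges n) (oe_matching n c f)"
  unfolding matching_def
proof (intro conjI ballI impI)
  show "oe_matching n c f \<subseteq> cycle_edges n"
    unfolding oe_matching_def cycle_edges_def by blast
next
  fix e g assume "e \<in> oe_matching n c f" "g \<in> oe_matching n c f" "e \<noteq> g"
  then obtain v w where v: "e = {v, v mod n + 1}" "v \<in> {1..n}" "even (int v - c)"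
    and w: "g = {w, w mod n + 1}" "w \<in> {1..n}" "even (int w - c)"
    unfolding oe_matching_def by blast
  have "v \<noteq> w" using v w \<open>e \<noteq> g\<close> by auto
  moreover have "v \<noteq> w mod n + 1" "w \<noteq> v mod n + 1"
    using odd_cycle_succ[OF w(2) assms, of c] odd_cycle_succ[OF v(2) assms, of c] v(3) w(3) by metis+
  moreover have "v mod n + 1 \<noteq> w mod n + 1" using cycle_succ_inj[OF v(2) w(2)] \<open>v \<noteq> w\<close> by blast
  ultimately show "e \<inter> g = {}" unfolding v(1) w(1) by blast
qed

lemma swap_along_edge:
  assumes "matching E M" "{v, w} \<in> M"
  shows "swap_along M v = w"
proof -
  have "u = w" if "{v, u} \<in> M" for u
  proof -
    have "{v, u} = {v, w} \<or> {v, u} \<inter> {v, w} = {}"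
      using assms(1)[unfolded matching_def, THEN conjunct2, rule_format, OF that assms(2)] by metis
    then have "{v, u} = {v, w}" by simp
    then show ?thesis by (metis doubleton_eq_iff)
  qed
  then have "(THE u. {v, u} \<in> M) = w" using assms(2) by blast
  then show ?thesis using assms(2) unfolding swap_along_def by metis
qed

lemma swap_along_oe:
  assumes "even n" "v \<in> {1..n}" and per: "\<And>i. f (i + int n) = f i + int n"
  shows "swap_along (oe_matching n c f) v \<in> {1..n} \<and>
    [int (swap_along (oe_matching n c f) v) = oe_move c f (int v)] (mod int n)"
proof (cases "even (int v - c)")
  case ev: True
  show ?thesis
  proof (cases "f (int v + 1) < f (int v)")
    case True
    then have "{v, v mod n + 1} \<in> oe_matching n c f"
      using assms(2) ev unfolding oe_matching_def by blast
    from swap_along_edge[OF matching_oe[OF assms(1)] this]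
    have "swap_along (oe_matching n c f) v = v mod n + 1" .
    moreover have "v mod n + 1 \<in> {1..n}" using cycle_succ[OF assms(2)] assms(2) by auto
    ultimately show ?thesis using ev True cycle_succ_cong[of v n] by (simp add: oe_move_def)
  next
    case False
    have "{v, w} \<notin> oe_matching n c f" for w
    proof
      assume "{v, w} \<in> oe_matching n c f"
      then obtain u where u: "{v, w} = {u, u mod n + 1}" "u \<in> {1..n}" "even (int u - c)"
        "f (int u + 1) < f (int u)" unfolding oe_matching_def by blast
      have "u \<noteq> v" using u(4) False by metis
      then have "v = u mod n + 1" using u(1) by (metis doubleton_eq_iff)
      then show False using u(3) ev odd_cycle_succ[OF u(2) assms(1), of c] by metis
    qed
    then show ?thesis using assms(2) ev False by (simp add: swap_along_def oe_move_def)
  qed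
next
  case od: False
  \<comment> \<open>Here \<open>v\<close> is the right end of its active edge, so only the edge to
    its cyclic predecessor \<open>u\<close> can be in the matching.\<close>
  define u where "u = (if v = 1 then n else v - 1)"
  have u: "u \<in> {1..n}" and vu: "v = u mod n + 1" using assms(2) unfolding u_def by auto
  have evu: "even (int u - c)" using odd_cycle_succ[OF u assms(1), of c] od vu by simp
  have cong: "[int v = int u + 1] (mod int n)" using cycle_succ_cong[of u n] vu by simp
  then have cong': "[int v - 1 = int u] (mod int n)" by (simp add: cong_iff_dvd_diff algebra_simps)
  have "f (int v) - int v = f (int u + 1) - (int u + 1)" "f (int v - 1) - (int v - 1) = f (int u) - int u"
    using periodic_cong[of f, OF per cong] periodic_cong[of f, OF per cong'] by auto
  then have iff: "f (int v) < f (int v - 1) \<longleftrightarrow> f (int u + 1) < f (int u)" by auto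
  show ?thesis
  proof (cases "f (int v) < f (int v - 1)")
    case True
    then have "{u, u mod n + 1} \<in> oe_matching n c f"
      using u evu iff unfolding oe_matching_def by blast
    then have "{v, u} \<in> oe_matching n c f" using vu by (metis insert_commute)
    from swap_along_edge[OF matching_oe[OF assms(1)] this]
    have "swap_along (oe_matching n c f) v = u" .
    then show ?thesis using u od True cong' by (simp add: oe_move_def cong_sym)
  next
    case False
    have "{v, w} \<notin> oe_matching n c f" for w
    proof
      assume "{v, w} \<in> oe_matching n c f"
      then obtain x where x: "{v, w} = {x, x mod n + 1}" "x \<in> {1..n}" "even (int x - c)"
        "f (int x + 1) < f (int x)" unfolding oe_matching_def by blast
      have "x \<noteq> v" using x(3) od by metis
      then have "x mod n + 1 = u mod n + 1" using x(1) vu by (metis doubleton_eq_iff)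
      then have "x = u" by (rule cycle_succ_inj[OF x(2) u])
      then show False using x(4) iff False by metis
    qed
    then show ?thesis using assms(2) od False by (simp add: swap_along_def oe_move_def)
  qed
qed

lemma cong_imp_eq_range:
  assumes "a \<in> {1..n}" "b \<in> {1..n}" "[int a = int b] (mod int n)"
  shows "a = b"
proof -
  have "int n dvd (int a - int b)" using assms(3) by (simp add: cong_iff_dvd_diff)
  moreover have "\<bar>int a - int b\<bar> < int n" using assms(1,2) by auto
  ultimately show ?thesis using dvd_imp_le_int[of "int a - int b" "int n"] by auto
qed

text \<open>The invariant is that the value of \<open>f\<close> at the current vertex of a pebble is
  its destination modulo \<open>n\<close>. Each step sorts \<open>f\<close> and moves the pebbles
  alike, and after \<open>T\<close> steps \<open>f\<close> is the identity.\<close>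

lemma routing_of_sort_bound:
  assumes "even n" "0 < n" "affine_perm (int n) f" "\<And>i. \<bar>f i - i\<bar> \<le> (B::int)" "sort_bound T c f"
    and "\<And>v. v \<in> {1..n} \<Longrightarrow> p v \<in> {1..n} \<and> \<pi> v \<in> {1..n} \<and> [f (int (p v)) = int (\<pi> v)] (mod int n)"
  shows "\<exists>q. (pebble_step (cycle_edges n) ^^ T) p q \<and> (\<forall>v\<in>{1..n}. q v = \<pi> v)"
  using assms(3-)
proof (induction T arbitrary: c f p)
  case 0
  have "f i = i" for i using sort_bound_0[OF 0(1) _ 0(2,3)] assms(2) by simp
  then have "p v = \<pi> v" if "v \<in> {1..n}" for v
    using 0(4)[OF that] cong_imp_eq_range[of "p v" n "\<pi> v"] by auto
  then show ?case by auto
next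
  case (Suc T)
  let ?M = "oe_matching n c f" and ?g = "oe_step c f"
  have per: "f (i + int n) = f i + int n" for i using Suc.prems(1) by (simp add: affine_perm_def)
  have ap: "affine_perm (int n) ?g" using affine_perm_oe_step[OF Suc.prems(1)] assms(1,2) by simp
  then have perg: "?g (i + int n) = ?g i + int n" for i by (simp add: affine_perm_def)
  have inv: "swap_along ?M (p v) \<in> {1..n} \<and> \<pi> v \<in> {1..n} \<and>
      [?g (int (swap_along ?M (p v))) = int (\<pi> v)] (mod int n)" if v: "v \<in> {1..n}" for v
  proof -
    have pv: "p v \<in> {1..n}" and c: "[f (int (p v)) = int (\<pi> v)] (mod int n)" and "\<pi> v \<in> {1..n}"
      using Suc.prems(4)[OF v] by auto
    let ?w = "int (swap_along ?M (p v))" and ?m = "oe_move c f (int (p v))"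
    have w: "[?w = ?m] (mod int n)" using swap_along_oe[OF assms(1) pv, of f c] per by blast
    have "?g ?w - ?w = ?g ?m - ?m" using periodic_cong[of ?g, OF perg w] .
    then have "?g ?w - f (int (p v)) = ?w - ?m" by (simp add: oe_step_move)
    then have "[?g ?w = f (int (p v))] (mod int n)" using w by (simp add: cong_iff_dvd_diff)
    then show ?thesis using c swap_along_oe[OF assms(1) pv, of f c] per \<open>\<pi> v \<in> {1..n}\<close>
      by (auto intro: cong_trans)
  qed
  have "\<exists>q. (pebble_step (cycle_edges n) ^^ T) (swap_along ?M \<circ> p) q \<and> (\<forall>v\<in>{1..n}. q v = \<pi> v)"
    by (rule Suc.IH[OF ap near_oe_step[of f B, OF Suc.prems(2)]
          sort_bound_oe_step[of f B, OF Suc.prems(2,3)]], unfold o_apply) (rule inv)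
  moreover have "pebble_step (cycle_edges n) p (swap_along ?M \<circ> p)"
    using matching_oe[OF assms(1)] unfolding pebble_step_def by blast
  ultimately show ?case by (meson relpowp_Suc_I2)
qed

subsection \<open>Words that take too long to sort\<close>

text \<open>The two hook words have base points \<open>d\<close> apart. \<open>h1\<close> and
  \<open>h2\<close> are the monotonicity constraints between them, once directly and once around the
  period. What remains is arithmetic.\<close>

lemma hook_offset:
  fixes p q n d a e a' e' :: int
  assumes "2 \<le> p" "2 \<le> q" "p + q = n" "d = 1 \<or> d = n - 1 \<or> 3 \<le> d \<and> d \<le> n - 3"
    and a: "0 \<le> a" "a < p" "p \<le> e" "e < n" "a = p - 1 \<or> e = p"
    and a': "0 \<le> a'" "a' < p" "p \<le> e'" "e' < n" "a' = p - 1 \<or> e' = p"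
    and h1: "\<And>j. (0 \<le> j \<and> j < p \<and> j \<noteq> a') \<or> j = e' \<or> n \<le> j \<longrightarrow>
      (0 \<le> j + d \<and> j + d < p \<and> j + d \<noteq> a) \<or> j + d = e \<or> n \<le> j + d"
    and h2: "\<And>j. (0 \<le> j \<and> j < p \<and> j \<noteq> a) \<or> j = e \<or> n \<le> j \<longrightarrow>
      (0 \<le> j + n - d \<and> j + n - d < p \<and> j + n - d \<noteq> a') \<or> j + n - d = e' \<or> n \<le> j + n - d"
  shows "(d = 1 \<and> a = 0 \<and> e = p \<and> a' = p - 1 \<and> e' = n - 1) \<or>
    (d = n - 1 \<and> a' = 0 \<and> e' = p \<and> a = p - 1 \<and> e = n - 1) \<or>
    (3 \<le> d \<and> d \<le> n - 3 \<and> q = 2 \<and> a = d - 1 \<and> e = p \<and> a' = n - d - 1 \<and> e' = p) \<or>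
    (3 \<le> d \<and> d \<le> n - 3 \<and> p = 2 \<and> a = 1 \<and> e = d \<and> a' = 1 \<and> e' = n - d)"
proof -
  consider "d = 1" | "d = n - 1" | "3 \<le> d" "d \<le> n - 3" using assms(4) by blast
  then show ?thesis
  proof cases
    case 1
    then show ?thesis using assms(1-3) a a' h1[of 0] h1[of "p - 1"] h1[of "p - 2"] h1[of "a - 1"] h1[of e']
      by (smt (verit))
  next
    case 2
    then show ?thesis using assms(1-3) a a' h2[of 0] h2[of "p - 1"] h2[of "p - 2"] h2[of "a' - 1"] h2[of e]
      by (smt (verit))
  next
    case 3
    show ?thesis
    proof (cases "q = 2")
      case True
      then have n: "n = p + 2" "e = p \<or> e = p + 1 \<and> a = p - 1" "e' = p \<or> e' = p + 1 \<and> a' = p - 1"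
        using assms(3) a a' by auto
      \<comment> \<open>The two values contradict each other; the same trick settles
        \<open>e'\<close>, and \<open>a\<close>, \<open>a'\<close> for \<open>p = 2\<close>.\<close>
      have "a' = p - d" "a' = p - 1 - d" if "e \<noteq> p"
        using that 3 n a' h1[of "p - d"] h1[of "p - 1 - d"] by auto
      then have "e = p" by fastforce
      have "a = d - 2" "a = d - 3" if "e' \<noteq> p"
        using that 3 n a h2[of "d - 2"] h2[of "d - 3"] by auto
      then have "e' = p" by fastforce
      with \<open>e = p\<close> show ?thesis
        using 3 n a a' True h1[of "p + 1 - d"] h2[of "d - 1"] by auto
    next
      case q: False
      show ?thesis
      proof (cases "p = 2")
        case True
        then have n: "a = 1 \<or> a = 0 \<and> e = 2" "a' = 1 \<or> a' = 0 \<and> e' = 2" using a a' by auto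
        have "e = d + 1" "e = d + 2" if "a' \<noteq> 1"
          using that 3 n(2) a True h1[of 1] h1[of 2] by auto
        then have "a' = 1" by fastforce
        have "e' = n - d + 1" "e' = n - d + 2" if "a \<noteq> 1"
          using that 3 n(1) a' True h2[of 1] h2[of 2] by auto
        then have "a = 1" by fastforce
        then show ?thesis
          using 3 \<open>a' = 1\<close> True assms(2,3) a a' h1[of 0] h2[of 0] by auto
      next
        case False
        \<comment> \<open>These offsets carry a 1 in the second undisturbed word and a 0 in the
          shifted first one, so each must be one of two exceptions. Three consecutive offsets of
          this kind exist once \<open>p\<close> and \<open>q\<close> are at least 3.\<close>
        have "j = a' \<or> j = e - d" if "0 \<le> j" "j < p" "p \<le> j + d" "j + d < n" for j
          using h1[of j] that by auto
        note * = this[of "max 0 (p - d)"] this[of "max 0 (p - d) + 1"] this[of "max 0 (p - d) + 2"]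
        have "max 0 (p - d) + 2 < p" "max 0 (p - d) + d + 2 < n"
          using False q 3 assms(1-3) by (auto simp: max_def)
        then show ?thesis using * by (auto simp: max_def split: if_splits)
      qed
    qed
  qed
qed

section \<open>Threshold words of a lift with distances between \<open>-p\<close> and
  \<open>q\<close>\<close>

locale boxed_perm =
  fixes n p q :: int and f :: "int \<Rightarrow> int"
  assumes affine: "affine_perm n f" and n_even: "even n" and n_ge: "6 \<le> n"
    and p_ge: "2 \<le> p" and q_ge: "2 \<le> q" and pq: "p + q = n"
    and box: "\<And>i. i - p \<le> f i" "\<And>i. f i \<le> i + q"

text \<open>\<open>high q f x\<close> is the 0-1 word of \<open>f\<close> for the threshold \<open>x + q - 1\<close>, read from position \<open>x\<close> on.
  With all distances in \<open>[-p, q]\<close> it is 0 at negative offsets and 1 from \<open>p + q\<close> on.\<close>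

definition high :: "int \<Rightarrow> (int \<Rightarrow> int) \<Rightarrow> int \<Rightarrow> int \<Rightarrow> bool" where
  "high q f x j \<longleftrightarrow> x + q \<le> f (x + j)"

text \<open>The worst word \<open>1\<^sup>p 0\<^sup>q\<close>, harmful for either parity of the
  first step.\<close>

definition block :: "int \<Rightarrow> int \<Rightarrow> (int \<Rightarrow> int) \<Rightarrow> int \<Rightarrow> bool" where
  "block p q f x \<longleftrightarrow> (\<forall>j. high q f x j \<longleftrightarrow> 0 \<le> j \<and> j < p \<or> p + q \<le> j)"

text \<open>The worst word with its letters at offsets \<open>a\<close> and \<open>e\<close>
  exchanged. The condition \<open>a = p - 1 \<or> e = p\<close> leaves the words in which a low
  entry at offset \<open>p - 1\<close> or \<open>p + 1\<close> has only one other entry out of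
  place.\<close>

definition hook :: "int \<Rightarrow> int \<Rightarrow> (int \<Rightarrow> int) \<Rightarrow> int \<Rightarrow> int \<Rightarrow> int \<Rightarrow> bool" where
  "hook p q f x a e \<longleftrightarrow> 0 \<le> a \<and> a < p \<and> p \<le> e \<and> e < p + q \<and> (a = p - 1 \<or> e = p) \<and>
     (\<forall>j. high q f x j \<longleftrightarrow> (0 \<le> j \<and> j < p \<and> j \<noteq> a) \<or> j = e \<or> p + q \<le> j)"

text \<open>Two hooks at an odd distance block both parities of the first step; the last three disjuncts
  are the only pairs of this kind.\<close>

definition jammed :: "int \<Rightarrow> int \<Rightarrow> (int \<Rightarrow> int) \<Rightarrow> bool" where
  "jammed p q f \<longleftrightarrow> (\<exists>x. block p q f x) \<or>
     (\<exists>x. hook p q f x 0 p \<and> hook p q f (x + 1) (p - 1) (p + q - 1)) \<or>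
     (\<exists>x d. odd d \<and> 3 \<le> d \<and> d \<le> p + q - 3 \<and>
       (q = 2 \<and> hook p q f x (d - 1) p \<and> hook p q f (x + d) (p + q - d - 1) p \<or>
        p = 2 \<and> hook p q f x 1 d \<and> hook p q f (x + d) 1 (p + q - d)))"

context boxed_perm
begin

lemma periodic: "f (i + n) = f i + n"
  using affine by (simp add: affine_perm_def)

lemma high_mono: "x \<le> y \<Longrightarrow> high q f y j \<Longrightarrow> high q f x (j + (y - x))"
  unfolding high_def by (simp add: algebra_simps)

lemma high_period: "high q f (x + n) j \<longleftrightarrow> high q f x j"
  using periodic[of "x + j"] by (simp add: high_def algebra_simps)

lemma high_period_mult: "high q f (x + k * n) j \<longleftrightarrow> high q f x j"
  using periodic_mult[of f n "x + j" k] periodic by (simp add: high_def algebra_simps)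

lemma not_high_neg: "j < 0 \<Longrightarrow> \<not> high q f x j"
  using box(2)[of "x + j"] by (simp add: high_def)

lemma high_ge: "n \<le> j \<Longrightarrow> high q f x j"
  using box(1)[of "x + j"] pq by (simp add: high_def)

lemma near: "\<bar>f i - i\<bar> \<le> p + q"
  using box[of i] p_ge q_ge by (simp add: abs_le_iff)

text \<open>The distances sum to zero, hence exactly \<open>p\<close> of the \<open>n\<close> values in a window exceed the threshold.\<close>

lemma card_high: "int (card {j \<in> {0..<n}. high q f x j}) = p"
proof -
  define I where "I = {x..<x + n}"
  \<comment> \<open>Subtracting \<open>n\<close> from the high values maps the window bijectively
    onto the interval from \<open>x - p\<close> to \<open>x + q - 1\<close>. Comparing sums then
    gives the number of subtractions.\<close>
  define r where "r i = f i - (if x + q \<le> f i then n else 0)" for i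
  have fin: "finite I" by (simp add: I_def)
  have rcong: "[r i = f i] (mod n)" for i
    by (simp add: r_def cong_iff_dvd_diff)
  have inj: "inj_on r I"
  proof (rule inj_onI)
    fix i j assume ij: "i \<in> I" "j \<in> I" "r i = r j"
    then have "[f i = f j] (mod n)" using rcong[of i] rcong[of j] by (metis cong_sym cong_trans)
    then have "n dvd i - j" using affine by (simp add: affine_perm_def cong_iff_dvd_diff)
    moreover have "\<bar>i - j\<bar> < n" using ij(1,2) by (auto simp: I_def)
    ultimately show "i = j" using dvd_imp_le_int[of "i - j" n] by force
  qed
  have "r ` I = {x - p..<x + q}"
  proof (rule card_subset_eq)
    show "r ` I \<subseteq> {x - p..<x + q}"
    proof
      fix y assume "y \<in> r ` I"
      then obtain i where "i \<in> I" "y = r i" by blast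
      then show "y \<in> {x - p..<x + q}" using box[of i] pq by (auto simp: I_def r_def)
    qed
    show "card (r ` I) = card {x - p..<x + q}"
      using card_image[OF inj] pq by (simp add: I_def)
  qed simp
  then have "sum r I = sum (\<lambda>y. y) {x - p..<x + q}"
    using sum.reindex[OF inj, of "\<lambda>y. y"] by simp
  also have "\<dots> = (\<Sum>i\<in>I. i - p)"
    by (rule sum.reindex_bij_witness[of _ "\<lambda>i. i - p" "\<lambda>i. i + p"]) (use pq in \<open>auto simp: I_def\<close>)
  finally have 1: "sum r I = (\<Sum>i\<in>I. i) - n * p"
    using n_ge by (simp add: sum_subtractf I_def)
  have "sum r I = sum f I - (\<Sum>i\<in>I. if x + q \<le> f i then n else 0)"
    by (simp add: r_def sum_subtractf)
  also have "(\<Sum>i\<in>I. if x + q \<le> f i then n else 0) = n * int (card {i \<in> I. x + q \<le> f i})"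
    using fin by (simp add: sum.If_cases Int_def)
  also have "sum f I = (\<Sum>i\<in>I. i)"
    using affine_perm_sum[OF affine, of x] n_ge by (simp add: I_def sum_subtractf)
  finally have "n * int (card {i \<in> I. x + q \<le> f i}) = n * p" using 1 by linarith
  then have "int (card {i \<in> I. x + q \<le> f i}) = p" using n_ge by simp
  moreover have "card {j \<in> {0..<n}. high q f x j} = card {i \<in> I. x + q \<le> f i}"
    by (rule bij_betw_same_card[of "\<lambda>j. x + j"], rule bij_betw_byWitness[where f' = "\<lambda>i. i - x"])
      (auto simp: I_def high_def)
  ultimately show ?thesis by simp
qed

text \<open>Of the \<open>n - 1\<close> other entries in the window, those that delay
  \<open>z\<close> are the high ones on its left and the low ones on its right. Exceeding
  \<open>n - 2\<close> therefore allows at most one entry of the opposite kind, and none unless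
  \<open>z\<close> idles.\<close>

lemma block_or_hook:
  assumes "\<not> sort_bound (nat (n - 2)) c f"
  shows "(\<exists>x. block p q f x) \<or> (\<exists>x a e. hook p q f x a e \<and> even (x + p + 1 - c))"
proof -
  obtain k z where z: "f z \<le> k" "\<exists>i<z. k < f i"
    and big: "nat (n - 2) < card {i. i < z \<and> k < f i} + card {i. z < i \<and> f i \<le> k} + idle c z"
    using assms unfolding sort_bound_def by (auto simp: not_le)
  \<comment> \<open>This base point turns the threshold \<open>k < f i\<close> into the letters of
    \<open>high q f x\<close>; \<open>t\<close> is the offset of \<open>z\<close>.\<close>
  define x where "x = k - q + 1"
  define t where "t = z - x"
  define H where "H = high q f x"
  have H: "H j \<longleftrightarrow> k < f (x + j)" for j by (auto simp: H_def high_def x_def)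
  have "\<not> H t" using z(1) by (simp add: H t_def)
  then have "t < n" using high_ge[of t x] by (force simp: H_def)
  obtain i where "i < z" "k < f i" using z(2) by blast
  then have "H (i - x)" "i - x < t" by (auto simp: H t_def)
  then have "0 < t" using not_high_neg[of "i - x" x] by (force simp: H_def)
  define L where "L = {j \<in> {0..<t}. H j}"
  define R where "R = {j \<in> {t<..<n}. \<not> H j}"
  define L' where "L' = {j \<in> {0..<t}. \<not> H j}"
  define R' where "R' = {j \<in> {t<..<n}. H j}"
  have "card {i. i < z \<and> k < f i} = card L"
  proof (rule sym, rule bij_betw_same_card[of "\<lambda>j. x + j"], rule bij_betw_byWitness[where f' = "\<lambda>i. i - x"])
    show "(\<lambda>i. i - x) ` {i. i < z \<and> k < f i} \<subseteq> L"
    proof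
      fix j assume "j \<in> (\<lambda>i. i - x) ` {i. i < z \<and> k < f i}"
      then have "H j" "j < t" by (auto simp: H t_def)
      then show "j \<in> L" using not_high_neg[of j x] by (force simp: L_def H_def)
    qed
  qed (auto simp: L_def H t_def)
  moreover have "card {i. z < i \<and> f i \<le> k} = card R"
  proof (rule sym, rule bij_betw_same_card[of "\<lambda>j. x + j"], rule bij_betw_byWitness[where f' = "\<lambda>i. i - x"])
    show "(\<lambda>i. i - x) ` {i. z < i \<and> f i \<le> k} \<subseteq> R"
    proof
      fix j assume "j \<in> (\<lambda>i. i - x) ` {i. z < i \<and> f i \<le> k}"
      then have "\<not> H j" "t < j" by (auto simp: H t_def)
      then show "j \<in> R" using high_ge[of j x] by (force simp: R_def H_def)
    qed
  qed (auto simp: R_def H t_def)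
  ultimately have big': "n - 2 < int (card L) + int (card R) + int (idle c z)"
    using big by linarith
  have fin: "finite L" "finite R" "finite L'" "finite R'"
    unfolding L_def R_def L'_def R'_def by (rule finite_subset[OF Collect_restrict], simp)+
  have "card L + card L' = card (L \<union> L')"
    using fin by (subst card_Un_disjoint) (auto simp: L_def L'_def)
  also have "L \<union> L' = {0..<t}" by (auto simp: L_def L'_def)
  finally have LL': "int (card L) + int (card L') = t" using \<open>0 < t\<close> by simp
  have "card R + card R' = card (R \<union> R')"
    using fin by (subst card_Un_disjoint) (auto simp: R_def R'_def)
  also have "R \<union> R' = {t<..<n}" by (auto simp: R_def R'_def)
  finally have RR': "int (card R) + int (card R') = n - t - 1" using \<open>t < n\<close> by simp
  have "card L + card R' = card (L \<union> R')"
    using fin by (subst card_Un_disjoint) (auto simp: L_def R'_def)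
  also have "L \<union> R' = {j \<in> {0..<n}. high q f x j}"
  proof -
    have "j < t \<or> t < j" if "H j" for j using that \<open>\<not> H t\<close> by (metis linorder_neqE)
    then show ?thesis using \<open>0 < t\<close> \<open>t < n\<close> unfolding L_def R'_def H_def[symmetric] by force
  qed
  finally have LR': "int (card L) + int (card R') = p" using card_high[of x] by simp
  have outer: "j < 0 \<longrightarrow> \<not> H j" for j using not_high_neg by (simp add: H_def)
  have outer': "n \<le> j \<longrightarrow> H j" for j using high_ge by (simp add: H_def)
  have not_t: "H j \<longrightarrow> j \<noteq> t" for j using \<open>\<not> H t\<close> by blast
  have L'_iff: "j \<in> L' \<longleftrightarrow> 0 \<le> j \<and> j < t \<and> \<not> H j" for j by (simp add: L'_def)
  have R'_iff: "j \<in> R' \<longleftrightarrow> t < j \<and> j < n \<and> H j" for j by (simp add: R'_def)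
  \<comment> \<open>Zero misplaced entries give the block; one gives \<open>t = p + 1\<close> or
    \<open>t = p - 1\<close>, which fixes the parity in the statement.\<close>
  have "card L' + card R' \<le> idle c z" using big' LL' RR' by linarith
  moreover have "idle c z \<le> 1" by (simp add: idle_def)
  ultimately consider "card L' = 0" "card R' = 0" | "card L' = 1" "card R' = 0" "idle c z = 1"
    | "card L' = 0" "card R' = 1" "idle c z = 1" by linarith
  then show ?thesis
  proof cases
    case 1
    then have e: "L' = {}" "R' = {}" "t = p" using fin LL' LR' by auto
    have "H j \<longleftrightarrow> 0 \<le> j \<and> j < p \<or> p + q \<le> j" for j
      using L'_iff[of j] R'_iff[of j] outer[of j] outer'[of j] not_t[of j] \<open>0 < t\<close> \<open>t < n\<close> pq
      unfolding e by (cases "H j") auto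
    then show ?thesis unfolding block_def H_def by blast
  next
    case 2
    obtain a where "L' = {a}" using card_1_singletonE[OF 2(1)] .
    moreover have "R' = {}" using 2(2) fin(4) by simp
    moreover have "t = p + 1" using LL' LR' 2 by linarith
    ultimately have e: "L' = {a}" "R' = {}" "t = p + 1" by auto
    have ev: "even (z - c)" using 2(3) by (simp add: idle_def split: if_splits)
    have a: "0 \<le> a" "a < p + 1" "\<not> H a" using L'_iff[of a] e by auto
    have Hj: "H j \<longleftrightarrow> 0 \<le> j \<and> j < p + 1 \<and> j \<noteq> a \<or> p + q \<le> j" for j
      using L'_iff[of j] R'_iff[of j] outer[of j] outer'[of j] not_t[of j] \<open>0 < t\<close> \<open>t < n\<close> pq
      unfolding e by (cases "H j") auto
    show ?thesis
    proof (cases "a = p")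
      case True
      then have "H j \<longleftrightarrow> 0 \<le> j \<and> j < p \<or> p + q \<le> j" for j using Hj[of j] by auto
      then show ?thesis unfolding block_def H_def by blast
    next
      case False
      have "H j \<longleftrightarrow> (0 \<le> j \<and> j < p \<and> j \<noteq> a) \<or> j = p \<or> p + q \<le> j" for j
        using Hj[of j] False a p_ge by auto
      then have "hook p q f x a p" using a False q_ge unfolding hook_def H_def by auto
      moreover have "even (x + p + 1 - c)" using ev e by (simp add: t_def algebra_simps)
      ultimately show ?thesis by blast
    qed
  next
    case 3
    obtain e where "R' = {e}" using card_1_singletonE[OF 3(2)] .
    moreover have "L' = {}" using 3(1) fin(3) by simp
    moreover have "t = p - 1" using LL' LR' 3 by linarith
    ultimately have e: "R' = {e}" "L' = {}" "t = p - 1" by auto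
    have ev: "even (z - c)" using 3(3) by (simp add: idle_def split: if_splits)
    have ee: "p \<le> e" "e < n" "H e" using R'_iff[of e] e by auto
    have "H j \<longleftrightarrow> (0 \<le> j \<and> j < p \<and> j \<noteq> p - 1) \<or> j = e \<or> p + q \<le> j" for j
      using L'_iff[of j] R'_iff[of j] outer[of j] outer'[of j] not_t[of j] \<open>0 < t\<close> \<open>t < n\<close> pq ee
      unfolding e by (cases "H j") auto
    then have "hook p q f x (p - 1) e" using ee pq p_ge unfolding hook_def H_def by auto
    moreover have "even (x + p + 1 - c)"
    proof -
      have "x + p + 1 - c = (z - c) + 2" using e by (simp add: t_def)
      then show ?thesis using ev by simp
    qed
    ultimately show ?thesis by blast
  qed
qed

lemma hook_period_mult: "hook p q f (x + k * n) a e \<longleftrightarrow> hook p q f x a e"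
  by (simp add: hook_def high_period_mult)

text \<open>The failures for \<open>c = 0\<close> and \<open>c = 1\<close> yield, unless there is a
  block, hooks at base points of different parity. Reduced modulo the even \<open>n\<close>, their
  distance stays odd, and \<open>hook_offset\<close> lists the possible pairs.\<close>

lemma jammed_of_not_sort_bound:
  assumes "\<And>c. \<not> sort_bound (nat (n - 2)) c f"
  shows "jammed p q f"
proof (cases "\<exists>x. block p q f x")
  case True
  then show ?thesis by (simp add: jammed_def)
next
  case False
  obtain x a e where h: "hook p q f x a e" "even (x + p + 1 - 0)"
    using block_or_hook[OF assms, of 0] False by blast
  obtain y a' e' where y: "hook p q f y a' e'" "even (y + p + 1 - 1)"
    using block_or_hook[OF assms, of 1] False by blast
  define d where "d = (y - x) mod n"
  have dmod: "y + (- ((y - x) div n)) * n = x + d"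
    using div_mult_mod_eq[of "y - x" n] by (simp add: d_def algebra_simps)
  have h': "hook p q f (x + d) a' e'"
    using y(1) hook_period_mult[of y "- ((y - x) div n)"] by (simp only: dmod)
  have "odd (y - x)" using h(2) y(2) by presburger
  then have "odd d" unfolding d_def using n_even by (simp add: dvd_mod_iff)
  moreover have "0 \<le> d" "d < n" using n_ge by (auto simp: d_def)
  ultimately have d: "d = 1 \<or> d = n - 1 \<or> 3 \<le> d \<and> d \<le> n - 3" using n_even by presburger
  have "(0 \<le> j \<and> j < p \<and> j \<noteq> a') \<or> j = e' \<or> n \<le> j \<longrightarrow>
      (0 \<le> j + d \<and> j + d < p \<and> j + d \<noteq> a) \<or> j + d = e \<or> n \<le> j + d" for j
    using high_mono[of x "x + d" j] h(1) h' \<open>0 \<le> d\<close> unfolding hook_def pq by simp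
  moreover have "(0 \<le> j \<and> j < p \<and> j \<noteq> a) \<or> j = e \<or> n \<le> j \<longrightarrow>
      (0 \<le> j + n - d \<and> j + n - d < p \<and> j + n - d \<noteq> a') \<or> j + n - d = e' \<or> n \<le> j + n - d" for j
    using high_mono[of "x + d" "x + n" j] h(1) h' \<open>d < n\<close> unfolding hook_def pq
    by (simp add: high_period add_diff_eq)
  ultimately have "(d = 1 \<and> a = 0 \<and> e = p \<and> a' = p - 1 \<and> e' = n - 1) \<or>
    (d = n - 1 \<and> a' = 0 \<and> e' = p \<and> a = p - 1 \<and> e = n - 1) \<or>
    (3 \<le> d \<and> d \<le> n - 3 \<and> q = 2 \<and> a = d - 1 \<and> e = p \<and> a' = n - d - 1 \<and> e' = p) \<or>
    (3 \<le> d \<and> d \<le> n - 3 \<and> p = 2 \<and> a = 1 \<and> e = d \<and> a' = 1 \<and> e' = n - d)"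
    using h(1) h' unfolding hook_def pq by (intro hook_offset[OF p_ge q_ge pq d]) auto
  \<comment> \<open>For \<open>d = n - 1\<close> the hook at \<open>x + d\<close> comes first and
    the one at \<open>x + n\<close> follows it at distance 1.\<close>
  then consider "hook p q f x 0 p" "hook p q f (x + 1) (p - 1) (n - 1)"
    | "hook p q f (x + (n - 1)) 0 p" "hook p q f (x + (n - 1) + 1) (p - 1) (n - 1)"
    | "3 \<le> d" "d \<le> n - 3" "q = 2" "hook p q f x (d - 1) p" "hook p q f (x + d) (n - d - 1) p"
    | "3 \<le> d" "d \<le> n - 3" "p = 2" "hook p q f x 1 d" "hook p q f (x + d) 1 (n - d)"
    using h(1) h' hook_period_mult[of x 1] by auto
  then show ?thesis
  proof cases
    case 1
    show ?thesis unfolding jammed_def pq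
      by (rule disjI2, rule disjI1, rule exI[of _ x]) (use 1 in simp)
  next
    case 2
    show ?thesis unfolding jammed_def pq
      by (rule disjI2, rule disjI1, rule exI[of _ "x + (n - 1)"]) (use 2 in simp)
  next
    case 3
    show ?thesis unfolding jammed_def pq
      by (rule disjI2, rule disjI2, rule exI[of _ x], rule exI[of _ d]) (use 3 \<open>odd d\<close> in simp)
  next
    case 4
    show ?thesis unfolding jammed_def pq
      by (rule disjI2, rule disjI2, rule exI[of _ x], rule exI[of _ d]) (use 4 \<open>odd d\<close> in simp)
  qed
qed

end

subsection \<open>Exchanging the directions of two pebbles\<close>

text \<open>The pebbles of the residue classes of \<open>u\<close> and \<open>v\<close> change
  direction: one gets an extra turn around the cycle, the other loses one, so destinations modulo
  \<open>n\<close> stay the same.\<close>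

definition transfer :: "int \<Rightarrow> int \<Rightarrow> int \<Rightarrow> (int \<Rightarrow> int) \<Rightarrow> int \<Rightarrow> int" where
  "transfer n u v f i = (if n dvd i - u then f i + n else if n dvd i - v then f i - n else f i)"

lemma transfer_cong: "[transfer n u v f i = f i] (mod n)"
  by (simp add: transfer_def cong_iff_dvd_diff)

lemma dvd_shift: "n dvd i + n - u \<longleftrightarrow> n dvd i - (u::int)"
  using dvd_add_left_iff[of n n "i - u"] by (simp add: algebra_simps)

lemma sum_residue:
  fixes n :: int
  assumes "0 < n"
  shows "(\<Sum>i\<in>{0..<n}. if n dvd i - u then m else 0) = (m::int)"
proof -
  have "(\<Sum>i\<in>{0..<n}. if n dvd i - u then m else 0) = (\<Sum>i\<in>{u..<u + n}. if n dvd i - u then m else 0)"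
    by (rule sum_period_shift[symmetric]) (simp_all add: assms dvd_shift)
  also have "\<dots> = (\<Sum>i\<in>{u..<u + n}. if i = u then m else 0)"
  proof (rule sum.cong)
    fix i assume "i \<in> {u..<u + n}"
    then have "\<bar>i - u\<bar> < n" by auto
    then have "n dvd i - u \<longleftrightarrow> i = u" using dvd_imp_le_int[of "i - u" n] by auto
    then show "(if n dvd i - u then m else 0) = (if i = u then m else 0)" by simp
  qed simp
  also have "\<dots> = m" using assms by simp
  finally show ?thesis .
qed

lemma affine_perm_transfer:
  assumes "affine_perm n f" "0 < n" "\<not> n dvd u - v"
  shows "affine_perm n (transfer n u v f)"
proof -
  have "n dvd u - v" if "n dvd i - u" "n dvd i - v" for i
    using dvd_diff[OF that(2,1)] by simp
  then have *: "transfer n u v f i - i =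
      (f i - i) + (if n dvd i - u then n else 0) + (if n dvd i - v then - n else 0)" for i
    using assms(3) by (auto simp: transfer_def)
  have "(\<Sum>i\<in>{0..<n}. transfer n u v f i - i) = 0"
    unfolding * sum.distrib sum_residue[OF assms(2)]
    using assms(1) by (simp add: affine_perm_def)
  moreover have "[i = j] (mod n)" if "[transfer n u v f i = transfer n u v f j] (mod n)" for i j
    using that transfer_cong[of n u v f i] transfer_cong[of n u v f j] assms(1)
    unfolding affine_perm_def by (metis cong_sym cong_trans)
  moreover have "transfer n u v f (i + n) = transfer n u v f i + n" for i
    using assms(1) by (simp add: affine_perm_def transfer_def dvd_shift)
  ultimately show ?thesis unfolding affine_perm_def by blast
qed

section \<open>Effect of an exchange of directions on the words\<close>

context boxed_perm
begin

text \<open>Monotonicity and periodicity combined, with the conditions as implications so that known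
  words can be unfolded in an instance.\<close>

lemma high_shift:
  "high q f s j \<longrightarrow> t + m * n \<le> s \<longrightarrow> high q f t (j + s - t - m * n)"
  using high_mono[of "t + m * n" s j] high_period_mult[of t m] by (simp add: algebra_simps)

lemma window:
  obtains k where "x \<le> y + k * n" "y + k * n < x + n"
proof -
  have "y + (- ((y - x) div n)) * n = x + (y - x) mod n"
    using div_mult_mod_eq[of "y - x" n] by (simp add: algebra_simps)
  then show ?thesis using that[of "- ((y - x) div n)"] n_ge by simp
qed

text \<open>Periodicity moves the base point into any chosen window, and the words are spelled out
  for comparison with a second family of words.\<close>

lemma jammed_window:
  assumes "jammed p q f"
  obtains
    (block) y where "x \<le> y" "y < x + n" "\<And>j. high q f y j \<longleftrightarrow> 0 \<le> j \<and> j < p \<or> n \<le> j"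
  | (stair) y where "x \<le> y" "y < x + n" "\<And>j. high q f y j \<longleftrightarrow> 1 \<le> j \<and> j \<le> p \<or> n \<le> j"
      "\<And>j. high q f (y + 1) j \<longleftrightarrow> 0 \<le> j \<and> j < p - 1 \<or> n - 1 \<le> j"
  | (low) y d where "x \<le> y" "y < x + n" "odd d" "3 \<le> d" "d \<le> n - 3" "q = 2"
      "\<And>j. high q f y j \<longleftrightarrow> 0 \<le> j \<and> j \<noteq> d - 1 \<and> j \<noteq> n - 1"
      "\<And>j. high q f (y + d) j \<longleftrightarrow> 0 \<le> j \<and> j \<noteq> n - d - 1 \<and> j \<noteq> n - 1"
  | (top) y d where "x \<le> y" "y < x + n" "odd d" "3 \<le> d" "d \<le> n - 3" "p = 2"
      "\<And>j. high q f y j \<longleftrightarrow> j = 0 \<or> j = d \<or> n \<le> j"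
      "\<And>j. high q f (y + d) j \<longleftrightarrow> j = 0 \<or> j = n - d \<or> n \<le> j"
proof -
  have hk: "hook p q f (y + k * n + r) a e \<longleftrightarrow> hook p q f (y + r) a e" for y k r a e
    using hook_period_mult[of "y + r" k a e] by (simp add: algebra_simps)
  have hookD: "high q f y j \<longleftrightarrow> (0 \<le> j \<and> j < p \<and> j \<noteq> a) \<or> j = e \<or> n \<le> j"
    if "hook p q f y a e" for y a e j
    using that unfolding hook_def pq by metis
  from assms consider y where "block p q f y"
    | y where "hook p q f y 0 p" "hook p q f (y + 1) (p - 1) (n - 1)"
    | y d where "odd d" "3 \<le> d" "d \<le> n - 3" "q = 2" "hook p q f y (d - 1) p" "hook p q f (y + d) (n - d - 1) p"
    | y d where "odd d" "3 \<le> d" "d \<le> n - 3" "p = 2" "hook p q f y 1 d" "hook p q f (y + d) 1 (n - d)"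
    unfolding jammed_def pq by metis
  then show ?thesis
  proof cases
    case (1 y)
    obtain k where k: "x \<le> y + k * n" "y + k * n < x + n" by (rule window)
    show ?thesis by (rule block[OF k]) (use 1 high_period_mult in \<open>simp add: block_def pq\<close>)
  next
    case (2 y)
    obtain k where k: "x \<le> y + k * n" "y + k * n < x + n" by (rule window)
    have "hook p q f (y + k * n) 0 p" "hook p q f (y + k * n + 1) (p - 1) (n - 1)"
      using 2 hook_period_mult hk by auto
    note h = this[THEN hookD]
    show ?thesis by (rule stair[OF k]; unfold h) (use p_ge q_ge pq in auto)
  next
    case (3 y d)
    obtain k where k: "x \<le> y + k * n" "y + k * n < x + n" by (rule window)
    have "hook p q f (y + k * n) (d - 1) p" "hook p q f (y + k * n + d) (n - d - 1) p"
      using 3 hook_period_mult hk by auto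
    note h = this[THEN hookD]
    show ?thesis by (rule low[OF k 3(1-4)]; unfold h) (use 3(2-4) pq in auto)
  next
    case (4 y d)
    obtain k where k: "x \<le> y + k * n" "y + k * n < x + n" by (rule window)
    have "hook p q f (y + k * n) 1 d" "hook p q f (y + k * n + d) 1 (n - d)"
      using 4 hook_period_mult hk by auto
    note h = this[THEN hookD]
    show ?thesis by (rule top[OF k 4(1-4)]; unfold h) (use 4(2-4) pq in auto)
  qed
qed

context
  fixes u v
  assumes not_high_u: "\<not> high q f (u + 1) (n - 1)" and high_v: "high q f v 0"
begin

lemma value_v: "f v = v + q"
  using high_v box(2)[of v] by (simp add: high_def)

text \<open>The last letter of the window at \<open>u + 1\<close> belongs to \<open>u + n\<close>.
  If it is low, the pebble at \<open>u\<close> has the extreme distance \<open>-p\<close>, just as a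
  high first letter at \<open>v\<close> means distance \<open>q\<close>.\<close>

lemma value_u: "f u = u - p"
  using not_high_u box(1)[of u] periodic[of u] pq by (simp add: high_def algebra_simps)

lemma u_ne_v: "\<not> n dvd u - v"
proof
  assume "n dvd u - v"
  then have "f u - u = f v - v" using periodic_cong[of f n u v] periodic by (simp add: cong_iff_dvd_diff)
  then show False using value_u value_v p_ge q_ge by simp
qed

text \<open>As \<open>p + q = n\<close>, the distances \<open>-p\<close> and \<open>q\<close> turn
  into each other.\<close>

lemma boxed_transfer: "boxed_perm n p q (transfer n u v f)"
proof
  show "affine_perm n (transfer n u v f)"
    using affine_perm_transfer[OF affine _ u_ne_v] n_ge by simp
  have *: "f i - i = f w - w" if "n dvd i - w" for i w
    using periodic_cong[of f n i w] periodic that by (simp add: cong_iff_dvd_diff)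
  show "i - p \<le> transfer n u v f i" "transfer n u v f i \<le> i + q" for i
    using *[of i u] *[of i v] value_u value_v box[of i] pq p_ge q_ge by (auto simp: transfer_def)
qed (use n_even n_ge p_ge q_ge pq in auto)

text \<open>After the exchange \<open>u\<close> has distance \<open>q\<close> and \<open>v\<close>
  has distance \<open>-p\<close>. So in every window, whatever the threshold, the letter at
  \<open>u\<close> becomes high and the letter at \<open>v\<close> becomes low.\<close>

lemma high_transfer:
  "high q (transfer n u v f) y j \<longleftrightarrow>
    (if n dvd y + j - u then 0 \<le> j else if n dvd y + j - v then n \<le> j else high q f y j)"
proof -
  have *: "f i - i = f w - w" if "n dvd i - w" for i w
    using periodic_cong[of f n i w] periodic that by (simp add: cong_iff_dvd_diff)
  show ?thesis using *[of "y + j" u] *[of "y + j" v] value_u value_v pq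
    by (auto simp: transfer_def high_def)
qed

lemma high_transfer_window:
  assumes "0 \<le> j" "j < n" "0 \<le> a" "a < n" "0 \<le> b" "b < n" "y + a = u + k * n" "y + b = v + l * n"
  shows "high q (transfer n u v f) y j \<longleftrightarrow> j = a \<or> j \<noteq> b \<and> high q f y j"
proof -
  have iff: "n dvd y + j - w \<longleftrightarrow> j = c" if "0 \<le> c" "c < n" "y + c = w + m * n" for w c m
  proof -
    have "y + j - w = (j - c) + m * n" using that by simp
    then have "n dvd y + j - w \<longleftrightarrow> n dvd j - c" by (metis dvd_add_times_triv_right_iff)
    moreover have "\<bar>j - c\<bar> < n" using assms(1,2) that by auto
    ultimately show ?thesis using dvd_imp_le_int[of "j - c" n] by auto
  qed
  show ?thesis
    using high_transfer[of y j] iff[of a u k] iff[of b v l] assms by auto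
qed

end

end

section \<open>Words that exclude a jam\<close>

context boxed_perm
begin

text \<open>A jam could be moved to a base point \<open>y\<close> in the window at \<open>x\<close>.
  Comparing its words with the one at \<open>x\<close> rules out every \<open>y\<close>; the next
  three lemmas argue in the same way.\<close>

lemma not_jammed_block:
  assumes A: "\<And>j. high q f x j \<longleftrightarrow> 1 \<le> j \<and> j < p \<or> n - 1 \<le> j"
  shows "\<not> jammed p q f"
proof
  assume "jammed p q f"
  then show False
  proof (cases rule: jammed_window[where x = x])
    case (block y)
    \<comment> \<open>\<open>up\<close> carries high letters from \<open>y\<close> back to
      \<open>x\<close>, and \<open>down\<close> carries them from \<open>x\<close> back to
      \<open>y - n\<close>. Here \<open>up[of 0]\<close> leaves \<open>y - x\<close> between 1 and
      \<open>p - 1\<close> or equal to \<open>n - 1\<close>; the other two instances exclude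
      these.\<close>
    note up = high_shift[of y _ x 0, unfolded A block] and down = high_shift[of x _ y "-1", unfolded A block]
    show False using up[of 0] up[of "p - (y - x)"] down[of "p - 1"] block(1,2) pq p_ge q_ge n_ge by auto
  next
    case (stair y)
    note up = high_shift[of y _ x 0, unfolded A stair] and down = high_shift[of x _ y "-1", unfolded A stair]
      and down1 = high_shift[of x _ "y + 1" "-1", unfolded A stair]
    show False using up[of p] up[of 1] up[of "p - (y - x)"] down[of "p - 1"] down1[of "p - 1"]
        stair(1,2) pq p_ge q_ge n_ge by auto
  next
    case (low y d)
    note up = high_shift[of y _ x 0, unfolded A low(7,8)] and down = high_shift[of x _ y "-1", unfolded A low(7,8)]
    show False using up[of 0] up[of "n - 2 - (y - x)"] down[of "y - x - 1"] down[of "d - 1 - n + (y - x)"]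
        low(1-6) pq p_ge q_ge n_ge by auto
  next
    case (top y d)
    note up = high_shift[of y _ x 0, unfolded A top(7,8)] and down = high_shift[of x _ y "-1", unfolded A top(7,8)]
    show False using up[of 0] up[of d] down[of 1] top(1-6) pq p_ge q_ge n_ge by auto
  qed
qed

lemma not_jammed_stair:
  assumes A: "\<And>j. high q f x j \<longleftrightarrow> 2 \<le> j \<and> j \<le> p \<or> n - 1 \<le> j"
    and A1: "\<And>j. high q f (x + 1) j \<longleftrightarrow> 1 \<le> j \<and> j < p - 1 \<or> n - 2 \<le> j"
  shows "\<not> jammed p q f"
proof
  assume "jammed p q f"
  then show False
  proof (cases rule: jammed_window[where x = x])
    case (block y)
    note up = high_shift[of y _ x 0, unfolded A A1 block] and down = high_shift[of x _ y "-1", unfolded A A1 block]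
      and up1 = high_shift[of y _ "x + 1" 0, unfolded A A1 block]
    show False using up[of 0] up1[of "p - (y - x)"] down[of p] block(1,2) pq p_ge q_ge n_ge by auto
  next
    case (stair y)
    note up = high_shift[of y _ x 0, unfolded A A1 stair] and down = high_shift[of x _ y "-1", unfolded A A1 stair]
      and up1 = high_shift[of y _ "x + 1" 0, unfolded A A1 stair]
    show False using up[of 1] up1[of "p - (y - x)"] down[of p] down[of "p - 1"]
        stair(1,2) pq p_ge q_ge n_ge by auto
  next
    case (low y d)
    note up = high_shift[of y _ x 0, unfolded A A1 low(7,8)] and down = high_shift[of x _ y "-1", unfolded A A1 low(7,8)]
      and up1 = high_shift[of y _ "x + 1" 0, unfolded A A1 low(7,8)]
      and down2 = high_shift[of x _ "y + d" "-1", unfolded A A1 low(7,8)]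
    show False using up[of 0] down[of "y - x - 1"] up1[of "n - 4"] down2[of "n - 2"]
        low(1-6) pq p_ge q_ge n_ge by auto
  next
    case (top y d)
    note up = high_shift[of y _ x 0, unfolded A A1 top(7,8)] and down = high_shift[of x _ y "-1", unfolded A A1 top(7,8)]
      and up1 = high_shift[of y _ "x + 1" 0, unfolded A A1 top(7,8)]
      and up2 = high_shift[of "y + d" _ "x + 1" 1, unfolded A A1 top(7,8)]
    show False using up[of 0] up1[of 0] down[of 2] up2[of 0] top(1-6) pq p_ge q_ge n_ge by auto
  qed
qed

lemma not_jammed_low:
  assumes d: "odd d" "3 \<le> d" "d \<le> n - 3" "q = 2"
    and A: "\<And>j. high q f x j \<longleftrightarrow> 1 \<le> j \<and> j \<noteq> d - 1"
    and A1: "\<And>j. high q f (x + d) j \<longleftrightarrow> 0 \<le> j \<and> j \<noteq> n - d \<and> j \<noteq> n - 1"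
  shows "\<not> jammed p q f"
proof
  assume "jammed p q f"
  then show False
  proof (cases rule: jammed_window[where x = x])
    case (block y)
    note up = high_shift[of y _ x 0, unfolded A A1 block] and down = high_shift[of x _ y "-1", unfolded A A1 block]
    show False using up[of 0] up[of "d - 1 - (y - x)"] down[of "y - x - 1"] down[of "y - x - 2"]
        d block(1,2) pq p_ge q_ge n_ge by auto
  next
    case (stair y)
    note up = high_shift[of y _ x 0, unfolded A A1 stair] and down = high_shift[of x _ y "-1", unfolded A A1 stair]
      and up1 = high_shift[of y _ "x + d" 0, unfolded A A1 stair]
    show False using up[of "d - 1 - (y - x)"] down[of "y - x - 1"] up1[of "n - d"]
        d stair(1,2) pq p_ge q_ge n_ge by auto
  next
    case (low y d')
    note up = high_shift[of y _ x 0, unfolded A A1 low(7,8)] and down = high_shift[of x _ y "-1", unfolded A A1 low(7,8)]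
      and up1 = high_shift[of y _ "x + d" 0, unfolded A A1 low(7,8)]
    \<comment> \<open>Parity is decisive: the words leave only \<open>y = x + 1\<close>, which would
      force \<open>d' = d - 1\<close>, and \<open>y = x + d\<close>, which would force
      \<open>d' - 1 = n - d\<close>.\<close>
    have "d' \<noteq> d - 1" "d' - 1 \<noteq> n - d" using d(1) low(3) n_even by presburger+
    then show False using up[of 0] up[of "d - 1 - (y - x)"] down[of "y - x - 1"] up1[of "n - d"]
        d low(1,2,4-6) pq p_ge q_ge n_ge by auto
  next
    case (top y d')
    then show False using d pq n_ge by simp
  qed
qed

lemma not_jammed_top:
  assumes d: "odd d" "3 \<le> d" "d \<le> n - 3" "p = 2"
    and A: "\<And>j. high q f x j \<longleftrightarrow> j = d \<or> n - 1 \<le> j"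
    and A1: "\<And>j. high q f (x + d) j \<longleftrightarrow> j = 0 \<or> j = n - d - 1 \<or> n \<le> j"
  shows "\<not> jammed p q f"
proof
  assume "jammed p q f"
  then show False
  proof (cases rule: jammed_window[where x = x])
    case (block y)
    note up = high_shift[of y _ x 0, unfolded A A1 block] and down = high_shift[of x _ y "-1", unfolded A A1 block]
    show False using up[of 0] up[of 1] down[of d] d block(1,2) pq p_ge q_ge n_ge by auto
  next
    case (stair y)
    note up = high_shift[of y _ x 0, unfolded A A1 stair] and down = high_shift[of x _ y "-1", unfolded A A1 stair]
    show False using up[of 1] up[of 2] down[of d] d stair(1,2) pq p_ge q_ge n_ge by auto
  next
    case (low y d')
    then show False using d pq n_ge by simp
  next
    case (top y d')
    note up = high_shift[of y _ x 0, unfolded A A1 top(7,8)] and down = high_shift[of x _ y "-1", unfolded A A1 top(7,8)]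
      and up1 = high_shift[of y _ "x + d" 0, unfolded A A1 top(7,8)]
    \<comment> \<open>Again parity decides: \<open>y = x + n - 1\<close> would force
      \<open>d' = d + 1\<close>, and \<open>y = x + d\<close> would force
      \<open>d' = n - d - 1\<close>.\<close>
    have "d' \<noteq> d + 1" "d' \<noteq> n - d - 1" using d(1) top(3) n_even by presburger+
    then show False using up[of 0] down[of d] up1[of d'] d top(1,2,4-6) pq p_ge q_ge n_ge by auto
  qed
qed

end

lemma (in boxed_perm) high_transfer_word:
  assumes uv: "\<not> high q f (u + 1) (n - 1)" "high q f v 0"
    and "0 \<le> a" "a < n" "0 \<le> b" "b < n" "y + a = u + k * n" "y + b = v + l * n"
  shows "high q (transfer n u v f) y j \<longleftrightarrow>
    0 \<le> j \<and> j < n \<and> (j = a \<or> j \<noteq> b \<and> high q f y j) \<or> n \<le> j"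
proof -
  interpret g: boxed_perm n p q "transfer n u v f" using boxed_transfer[OF uv] .
  show ?thesis
    using high_transfer_window[OF uv _ _ assms(3-8), of j] g.not_high_neg[of j y] g.high_ge[of j y]
    by (cases "j < 0"; cases "n \<le> j") auto
qed

text \<open>A jammed word at \<open>y\<close> ends in a low letter, so the pebble at
  \<open>y - 1\<close> has distance \<open>-p\<close>. Its first letter is high, which gives
  distance \<open>q\<close> at \<open>y\<close>, except in the stair, where the word at
  \<open>y + 1\<close> supplies that pebble. Exchanging these two yields the words excluded
  above.\<close>

lemma (in boxed_perm) unjam:
  assumes "jammed p q f"
  shows "\<exists>g. boxed_perm n p q g \<and> (\<forall>i. [g i = f i] (mod n)) \<and> \<not> jammed p q g"
proof -
  have *: ?thesis if "\<not> high q f (u + 1) (n - 1)" "high q f v 0"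
    "boxed_perm n p q (transfer n u v f) \<Longrightarrow> \<not> jammed p q (transfer n u v f)" for u v
    using boxed_transfer[OF that(1,2)] that(3) transfer_cong by blast
  show ?thesis using assms
  proof (cases rule: jammed_window[where x = 0])
    case (block y)
    have uv: "\<not> high q f (y - 1 + 1) (n - 1)" "high q f y 0"
      using block(3) p_ge q_ge pq by auto
    show ?thesis
    proof (rule *[OF uv])
      assume "boxed_perm n p q (transfer n (y - 1) y f)"
      then interpret g: boxed_perm n p q "transfer n (y - 1) y f" .
      show "\<not> jammed p q (transfer n (y - 1) y f)"
      proof (rule g.not_jammed_block[of y])
        fix j
        show "high q (transfer n (y - 1) y f) y j \<longleftrightarrow> 1 \<le> j \<and> j < p \<or> n - 1 \<le> j"
          using high_transfer_word[OF uv, of "n - 1" 0 y 1 0 j] block(3)[of j] p_ge q_ge pq n_ge by auto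
      qed
    qed
  next
    case (stair y)
    have uv: "\<not> high q f (y - 1 + 1) (n - 1)" "high q f (y + 1) 0"
      using stair(3,4) p_ge q_ge pq by auto
    show ?thesis
    proof (rule *[OF uv])
      let ?g = "transfer n (y - 1) (y + 1) f"
      assume "boxed_perm n p q ?g"
      then interpret g: boxed_perm n p q ?g .
      show "\<not> jammed p q ?g"
      proof (rule g.not_jammed_stair[of y])
        fix j
        show "high q ?g y j \<longleftrightarrow> 2 \<le> j \<and> j \<le> p \<or> n - 1 \<le> j"
          using high_transfer_word[OF uv, of "n - 1" 1 y 1 0 j] stair(3)[of j] p_ge q_ge pq n_ge by auto
        show "high q ?g (y + 1) j \<longleftrightarrow> 1 \<le> j \<and> j < p - 1 \<or> n - 2 \<le> j"
          using high_transfer_word[OF uv, of "n - 2" 0 "y + 1" 1 0 j] stair(4)[of j] p_ge q_ge pq n_ge by auto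
      qed
    qed
  next
    case (low y d)
    have uv: "\<not> high q f (y - 1 + 1) (n - 1)" "high q f y 0"
      using low p_ge q_ge pq by auto
    show ?thesis
    proof (rule *[OF uv])
      let ?g = "transfer n (y - 1) y f"
      assume "boxed_perm n p q ?g"
      then interpret g: boxed_perm n p q ?g .
      show "\<not> jammed p q ?g"
      proof (rule g.not_jammed_low[OF low(3-6), of y])
        fix j
        show "high q ?g y j \<longleftrightarrow> 1 \<le> j \<and> j \<noteq> d - 1"
          using high_transfer_word[OF uv, of "n - 1" 0 y 1 0 j] low(7)[of j] low(4,5) n_ge by auto
        show "high q ?g (y + d) j \<longleftrightarrow> 0 \<le> j \<and> j \<noteq> n - d \<and> j \<noteq> n - 1"
          using high_transfer_word[OF uv, of "n - d - 1" "n - d" "y + d" 1 1 j] low(8)[of j] low(4,5) n_ge by auto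
      qed
    qed
  next
    case (top y d)
    have uv: "\<not> high q f (y - 1 + 1) (n - 1)" "high q f y 0"
      using top p_ge q_ge pq by auto
    show ?thesis
    proof (rule *[OF uv])
      let ?g = "transfer n (y - 1) y f"
      assume "boxed_perm n p q ?g"
      then interpret g: boxed_perm n p q ?g .
      show "\<not> jammed p q ?g"
      proof (rule g.not_jammed_top[OF top(3-6), of y])
        fix j
        show "high q ?g y j \<longleftrightarrow> j = d \<or> n - 1 \<le> j"
          using high_transfer_word[OF uv, of "n - 1" 0 y 1 0 j] top(7)[of j] top(4,5) n_ge by auto
        show "high q ?g (y + d) j \<longleftrightarrow> j = 0 \<or> j = n - d - 1 \<or> n \<le> j"
          using high_transfer_word[OF uv, of "n - d - 1" "n - d" "y + d" 1 1 j] top(8)[of j] top(4,5) n_ge by auto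
      qed
    qed
  qed
qed

subsection \<open>Balanced lifts\<close>

lemma affine_perm_lift:
  assumes "\<pi> permutes {1..n}" "0 < n"
  shows "\<exists>f. affine_perm (int n) f \<and> (\<forall>v\<in>{1..n}. f (int v) = int (\<pi> v))"
proof -
  \<comment> \<open>The representative of \<open>i\<close> modulo \<open>n\<close> in
    \<open>{1..n}\<close> instead of \<open>{0..<n}\<close>.\<close>
  define r where "r i = nat ((i - 1) mod int n + 1)" for i
  define f where "f i = int (\<pi> (r i)) + (i - int (r i))" for i
  have r: "r i \<in> {1..n}" for i
  proof -
    have "0 \<le> (i - 1) mod int n" "(i - 1) mod int n < int n" using assms(2) by auto
    then show ?thesis by (auto simp: r_def)
  qed
  have r_cong: "[int (r i) = i] (mod int n)" for i
  proof -
    have "0 \<le> (i - 1) mod int n" using assms(2) by simp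
    then have "int (r i) = (i - 1) mod int n + 1" by (simp add: r_def)
    then show ?thesis by (simp add: cong_def mod_simps)
  qed
  have r_id: "r (int v) = v" if "v \<in> {1..n}" for v
    using cong_imp_eq_range[OF r that] r_cong by blast
  have f_cong: "[f i = int (\<pi> (r i))] (mod int n)" for i
    using r_cong[of i] by (simp add: f_def cong_iff_dvd_diff dvd_diff_commute)
  have \<pi>_range: "\<pi> v \<in> {1..n}" if "v \<in> {1..n}" for v
    using that permutes_in_image[OF assms(1)] by blast
  have "f (i + int n) = f i + int n" for i
  proof -
    have "i + int n - 1 = (i - 1) + int n" by simp
    then have "r (i + int n) = r i" unfolding r_def by (metis mod_add_self2)
    then show ?thesis by (simp add: f_def)
  qed
  moreover from this have per: "f (i + int n) - (i + int n) = f i - i" for i by simp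
  moreover have "[i = j] (mod int n)" if "[f i = f j] (mod int n)" for i j
  proof -
    have "[int (\<pi> (r i)) = int (\<pi> (r j))] (mod int n)"
      using that f_cong[of i] f_cong[of j] by (metis cong_sym cong_trans)
    then have "\<pi> (r i) = \<pi> (r j)" using cong_imp_eq_range \<pi>_range r by blast
    then have "r i = r j" using permutes_inj[OF assms(1)] by (simp add: inj_eq)
    then show ?thesis using r_cong[of i] r_cong[of j] by (metis cong_sym cong_trans)
  qed
  moreover have "(\<Sum>i\<in>{0..<int n}. f i - i) = 0"
  proof -
    have "(\<Sum>i\<in>{0..<int n}. f i - i) = (\<Sum>i\<in>{1..<1 + int n}. f i - i)"
      using sum_period_shift[of "int n" "\<lambda>i. f i - i" 1] per assms(2) by simp
    also have "\<dots> = (\<Sum>v\<in>{1..n}. f (int v) - int v)"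
      by (rule sum.reindex_bij_witness[of _ int nat]) auto
    also have "\<dots> = (\<Sum>v\<in>{1..n}. int (\<pi> v) - int v)"
      by (rule sum.cong) (auto simp: f_def r_id)
    also have "\<dots> = 0"
      using sum.permute[OF assms(1), of int] by (simp add: sum_subtractf comp_def)
    finally show ?thesis .
  qed
  moreover have "f (int v) = int (\<pi> v)" if "v \<in> {1..n}" for v
    using r_id[OF that] by (simp add: f_def)
  ultimately show ?thesis unfolding affine_perm_def by blast
qed

text \<open>Adding or subtracting \<open>n\<close> changes a square by \<open>n\<^sup>2\<close> plus
  or minus \<open>2 * n\<close> times the distance. The sum drops exactly when the distance at
  \<open>v\<close> exceeds that at \<open>u\<close> by more than \<open>n\<close>.\<close>

lemma sum_squares_transfer:
  fixes n :: int
  assumes "affine_perm n f" "0 < n" "\<not> n dvd u - v"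
  shows "(\<Sum>i\<in>{0..<n}. (transfer n u v f i - i)\<^sup>2) =
    (\<Sum>i\<in>{0..<n}. (f i - i)\<^sup>2) + 2 * n * (n + (f u - u) - (f v - v))"
proof -
  have per: "f (i + n) = f i + n" for i using assms(1) by (simp add: affine_perm_def)
  have eq: "f i - i = f w - w" if "n dvd i - w" for i w
    using periodic_cong[of f n i w] per that by (simp add: cong_iff_dvd_diff)
  have disjoint: "\<not> (n dvd i - u \<and> n dvd i - v)" for i
    using dvd_diff[of n "i - v" "i - u"] assms(3) by auto
  have *: "(transfer n u v f i - i)\<^sup>2 = (f i - i)\<^sup>2 +
      (if n dvd i - u then n\<^sup>2 + 2 * n * (f u - u) else 0) +
      (if n dvd i - v then n\<^sup>2 - 2 * n * (f v - v) else 0)" for i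
  proof -
    have "(f i + n - i)\<^sup>2 = (f i - i)\<^sup>2 + n\<^sup>2 + 2 * n * (f i - i)"
      "(f i - n - i)\<^sup>2 = (f i - i)\<^sup>2 + n\<^sup>2 - 2 * n * (f i - i)"
      by (simp_all add: power2_eq_square algebra_simps)
    then show ?thesis
      using eq[of i u] eq[of i v] disjoint[of i] by (auto simp: transfer_def)
  qed
  show ?thesis
    unfolding * sum.distrib sum_residue[OF assms(2)]
    by (simp add: power2_eq_square algebra_simps)
qed

text \<open>In a lift with minimal sum of squared distances, two distances more than
  \<open>n\<close> apart could be exchanged at a profit.\<close>

lemma balanced_lift:
  assumes "affine_perm n f0" "0 < n"
  shows "\<exists>f. affine_perm n f \<and> (\<forall>i. [f i = f0 i] (mod n)) \<and> (\<forall>i j. (f i - i) - (f j - j) \<le> n)"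
proof -
  define P where "P f \<longleftrightarrow> affine_perm n f \<and> (\<forall>i. [f i = f0 i] (mod n))" for f
  define m where "m f = nat (\<Sum>i\<in>{0..<n}. (f i - i)\<^sup>2)" for f
  have "P f0" using assms(1) by (simp add: P_def)
  then obtain f where f: "P f" and least: "\<And>g. P g \<Longrightarrow> m f \<le> m g"
    using ex_has_least_nat[of P f0 m] by blast
  have af: "affine_perm n f" using f by (simp add: P_def)
  have "(f v - v) - (f u - u) \<le> n" for u v
  proof (rule ccontr)
    assume far: "\<not> ?thesis"
    have nd: "\<not> n dvd u - v"
    proof
      assume "n dvd u - v"
      then have "f u - u = f v - v"
        using periodic_cong[of f n u v] af by (simp add: affine_perm_def cong_iff_dvd_diff)
      then show False using far assms(2) by simp
    qed
    have "[transfer n u v f i = f0 i] (mod n)" for i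
      using cong_trans[OF transfer_cong, of f i "f0 i" n] f by (simp add: P_def)
    then have "P (transfer n u v f)"
      using affine_perm_transfer[OF af assms(2) nd] by (simp add: P_def)
    then have "m f \<le> m (transfer n u v f)" by (rule least)
    moreover have "0 \<le> (\<Sum>i\<in>{0..<n}. (f i - i)\<^sup>2)" "0 \<le> (\<Sum>i\<in>{0..<n}. (transfer n u v f i - i)\<^sup>2)"
      by (simp_all add: sum_nonneg)
    ultimately have "0 \<le> 2 * n * (n + (f u - u) - (f v - v))"
      using sum_squares_transfer[OF af assms(2) nd] by (simp add: m_def)
    then show False using far assms(2) by (simp add: zero_le_mult_iff)
  qed
  then show ?thesis using f unfolding P_def by blast
qed

text \<open>The one large value uses up the whole sum, so every other residue class has value
  0.\<close>

lemma sum_concentrated: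
  fixes g :: "int \<Rightarrow> int"
  assumes "0 < n" and per: "\<And>i. g (i + n) = g i" and nonneg: "\<And>i. 0 \<le> g i"
    and sum: "(\<Sum>i\<in>{0..<n}. g i) = n" and k: "n \<le> g k"
  shows "n dvd g i"
proof -
  have s: "(\<Sum>i\<in>{k..<k + n}. g i) = n" using sum_period_shift[of n g, OF assms(1) per] sum by simp
  have "(\<Sum>i\<in>{k..<k + n}. g i) = g k + (\<Sum>i\<in>{k..<k + n} - {k}. g i)"
    using assms(1) by (intro sum.remove) auto
  moreover have "0 \<le> (\<Sum>i\<in>{k..<k + n} - {k}. g i)" using nonneg by (simp add: sum_nonneg)
  ultimately have gk: "g k = n" and "(\<Sum>i\<in>{k..<k + n} - {k}. g i) = 0" using s k by auto
  then have z: "\<forall>i\<in>{k..<k + n} - {k}. g i = 0"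
    using sum_nonneg_eq_0_iff[of "{k..<k + n} - {k}" g] nonneg by simp
  have "[i = k + (i - k) mod n] (mod n)"
    by (simp add: cong_def mod_simps)
  then have "g i = g (k + (i - k) mod n)"
    using periodic_cong[of "\<lambda>i. g i + i" n i "k + (i - k) mod n"] per by simp
  moreover have "k + (i - k) mod n \<in> {k..<k + n}" using assms(1) by simp
  ultimately show ?thesis using z gk by (cases "k + (i - k) mod n = k") auto
qed

text \<open>The largest distance serves as \<open>q\<close> when it lies between 2 and
  \<open>n - 2\<close>. Otherwise either \<open>q = 2\<close> still works, or the distances are
  concentrated on one pebble that goes around against all the others, which is a rotation.\<close>

lemma boxed_or_rotation:
  assumes af: "affine_perm n f" and n: "even n" "6 \<le> n" and bal: "\<And>i j. (f i - i) - (f j - j) \<le> n"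
  shows "(\<exists>p q. boxed_perm n p q f) \<or> (\<forall>i. [f i = i + 1] (mod n)) \<or> (\<forall>i. [f i = i - 1] (mod n))"
proof -
  define s where "s i = f i - i" for i
  have per: "s (i + n) = s i" for i using af by (simp add: affine_perm_def s_def)
  have sum0: "(\<Sum>i\<in>{0..<n}. s i) = 0" using af by (simp add: affine_perm_def s_def)
  have box: "boxed_perm n (n - q) q f" if "2 \<le> q" "q \<le> n - 2" "\<And>i. q - n \<le> s i" "\<And>i. s i \<le> q" for q
  proof
    show "i - (n - q) \<le> f i" "f i \<le> i + q" for i
      using that(3,4)[of i] by (simp_all add: s_def algebra_simps)
  qed (use af n that in auto)
  consider k where "2 \<le> s k" "s k \<le> n - 2" "\<forall>i. s i \<le> s k" | k where "n - 1 \<le> s k"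
    | "\<forall>i. s i \<le> 1"
  proof -
    define A where "A = Max (s ` {0..<n})"
    have "A \<in> s ` {0..<n}" unfolding A_def using n by (intro Max_in) auto
    then obtain k where k: "s k = A" by blast
    have le: "s i \<le> A" for i
    proof -
      have "[i = i mod n] (mod n)" by (simp add: cong_def)
      then have "s i = s (i mod n)"
        using periodic_cong[of f n i "i mod n"] af by (simp add: affine_perm_def s_def)
      then show ?thesis unfolding A_def using n by (intro Max_ge) auto
    qed
    consider "n - 1 \<le> A" | "2 \<le> A" "A \<le> n - 2" | "A \<le> 1" by linarith
    then show ?thesis
    proof cases
      case 1
      then show ?thesis using that(2) k by blast
    next
      case 2
      then show ?thesis using that(1) k le by blast
    next
      case 3
      then show ?thesis using that(3) le order_trans by blast
    qed
  qed
  then show ?thesis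
  proof cases
    case (1 k)
    then have "boxed_perm n (n - s k) (s k) f"
      using bal[of k] by (intro box) (auto simp: s_def algebra_simps)
    then show ?thesis by blast
  next
    case (2 k)
    \<comment> \<open>A distance of at least \<open>n - 1\<close> pushes all others up to at least
      \<open>-1\<close>, so \<open>s i + 1\<close> is nonnegative with sum \<open>n\<close>.\<close>
    have "n dvd s i + 1" for i
    proof (rule sum_concentrated[of n "\<lambda>i. s i + 1" k])
      show "0 \<le> s i + 1" for i using bal[of k i] 2 by (simp add: s_def)
      show "(\<Sum>i\<in>{0..<n}. s i + 1) = n" using sum0 n by (simp add: sum.distrib)
    qed (use per 2 n in auto)
    then have "[f i = i - 1] (mod n)" for i by (simp add: cong_iff_dvd_diff s_def algebra_simps)
    then show ?thesis by blast
  next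
    case 3
    show ?thesis
    \<comment> \<open>The box need not be tight: \<open>q = 2\<close> is allowed although no
      distance exceeds 1.\<close>
    proof (cases "\<forall>i. 2 - n \<le> s i")
      case True
      then have "boxed_perm n (n - 2) 2 f" using 3 n by (intro box) (auto intro: order_trans)
      then show ?thesis by blast
    next
      case False
      then obtain k where k: "s k < 2 - n" by (auto simp: not_le)
      have "n dvd 1 - s i" for i
      proof (rule sum_concentrated[of n "\<lambda>i. 1 - s i" k])
        show "(\<Sum>i\<in>{0..<n}. 1 - s i) = n" using sum0 n by (simp add: sum_subtractf)
      qed (use per 3 k n in auto)
      then have "n dvd s i - 1" for i by (metis dvd_diff_commute)
      then have "[f i = i + 1] (mod n)" for i by (simp add: cong_iff_dvd_diff s_def diff_diff_eq)
      then show ?thesis by blast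
    qed
  qed
qed

theorem theorem2:
  fixes n :: nat and \<pi> :: "nat \<Rightarrow> nat"
  assumes "n \<ge> 6" and "even n"
    and "\<pi> permutes {1..n}"
    and "rt (cycle_vertices n) (cycle_edges n) \<pi> = n - 1"
  shows "(\<forall>i\<in>{1..n}. [int (\<pi> i) = int i + 1] (mod int n)) \<or>
         (\<forall>i\<in>{1..n}. [int (\<pi> i) = int i - 1] (mod int n))"
proof (rule ccontr)
  assume not_rotation: "\<not> ?thesis"
  obtain f0 where f0: "affine_perm (int n) f0" "\<forall>v\<in>{1..n}. f0 (int v) = int (\<pi> v)"
    using affine_perm_lift[OF assms(3)] assms(1) by auto
  obtain f where f: "affine_perm (int n) f" "\<And>i. [f i = f0 i] (mod int n)"
    "\<And>i j. (f i - i) - (f j - j) \<le> int n"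
    using balanced_lift[OF f0(1)] assms(1) by auto
  have f_\<pi>: "[f (int v) = int (\<pi> v)] (mod int n)" if "v \<in> {1..n}" for v
    using f(2)[of "int v"] f0(2) that by simp
  have "\<not> (\<forall>i. [f i = i + 1] (mod int n))" "\<not> (\<forall>i. [f i = i - 1] (mod int n))"
    using not_rotation f_\<pi> by (meson cong_sym cong_trans)+
  then obtain p q where "boxed_perm (int n) p q f"
    using boxed_or_rotation[OF f(1) _ _ f(3)] assms(1,2) by auto
  then interpret f: boxed_perm "int n" p q f .
  obtain g where "boxed_perm (int n) p q g" and g: "\<And>i. [g i = f i] (mod int n)" and "\<not> jammed p q g"
  proof (cases "jammed p q f")
    case True
    then show ?thesis using f.unjam that by blast
  next
    case False
    then show ?thesis using that[of f] f.boxed_perm_axioms by simp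
  qed
  then interpret g: boxed_perm "int n" p q g by simp
  \<comment> \<open>\<open>c\<close> is a parity of the first step for which sorting
    \<open>g\<close> takes at most \<open>n - 2\<close> steps.\<close>
  obtain c where "sort_bound (nat (int n - 2)) c g"
    using g.jammed_of_not_sort_bound \<open>\<not> jammed p q g\<close> by blast
  moreover have "nat (int n - 2) = n - 2" by simp
  ultimately have "sort_bound (n - 2) c g" by simp
  moreover have "id v \<in> {1..n} \<and> \<pi> v \<in> {1..n} \<and> [g (int (id v)) = int (\<pi> v)] (mod int n)"
    if "v \<in> {1..n}" for v
    using that permutes_in_image[OF assms(3), of v] cong_trans[OF g f_\<pi>] by simp
  ultimately have "\<exists>h. (pebble_step (cycle_edges n) ^^ (n - 2)) id h \<and> (\<forall>v\<in>{1..n}. h v = \<pi> v)"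
    using assms(1,2) g.near by (intro routing_of_sort_bound[OF assms(2) _ g.affine]) auto
  then have "routable_in (cycle_vertices n) (cycle_edges n) \<pi> (n - 2)"
    by (simp add: routable_in_def cycle_vertices_def)
  then have "rt (cycle_vertices n) (cycle_edges n) \<pi> \<le> n - 2"
    unfolding rt_def by (rule Least_le)
  then show False using assms(1,4) by simp
qed

end
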